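(* Let $R$ be a ring. (a) If $J(R) \neq 0$ and $2 \in U(R)$, then $G(R)$ is not a bipartite graph. (b) If $2 \notin U(R)$, then $G(R)$ is a bipartite graph if and only if $G(R/J(R))$ is a bipartite graph. (c) If $R$ is a semisimple left Artinian ring, then $G(R)$ is a bipartite graph if and only if either $R \cong \mathbb{Z}_3$ or $R$ contains a summand isomorphic to $\mathbb{Z}_2$.
   Context: Rings are associative, not necessarily commutative, with identity $1 \neq 0$. $U(R)$ is the set of units of $R$, $J(R)$ is the Jacobson radical of $R$, and $\mathbb{Z}_n$ is the ring of integers modulo $n$. The unit graph $G(R)$ is the simple graph whose vertices are the elements of $R$, where two distinct vertices $a, b$ are adjacent if and only if $a+b \in U(R)$. A graph is bipartite if its vertex set admits a partition into two classes such that vertices in the same class are not adjacent. "$R$ contains a summand isomorphic to $\mathbb{Z}_2$" means that $\mathbb{Z}_2$ is a direct factor of $R$ as a ring, i.e. $R \cong \mathbb{Z}_2 \times S$ for some (possibly zero) ring $S$. *)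

theory Defs
  imports "HOL-Algebra.Algebra" "HOL-Number_Theory.Residues"
begin

text \<open>
  HOL-Algebra only provides two-sided ideals and has no Jacobson radical.
\<close>

definition left_ideal :: "('a, 'b) ring_scheme \<Rightarrow> 'a set \<Rightarrow> bool" where
  "left_ideal R I \<longleftrightarrow>
     additive_subgroup I R \<and> (\<forall>x \<in> carrier R. \<forall>a \<in> I. x \<otimes>\<^bsub>R\<^esub> a \<in> I)"

definition maximal_left_ideal :: "('a, 'b) ring_scheme \<Rightarrow> 'a set \<Rightarrow> bool" where
  "maximal_left_ideal R M \<longleftrightarrow>
     left_ideal R M \<and> M \<noteq> carrier R \<and>
     (\<forall>I. left_ideal R I \<and> M \<subseteq> I \<longrightarrow> I = M \<or> I = carrier R)"

text \<open>
  The intersection with the carrier only matters for the zero ring, which has no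
  maximal left ideals.
\<close>

definition jacobson_radical :: "('a, 'b) ring_scheme \<Rightarrow> 'a set" where
  "jacobson_radical R = carrier R \<inter> \<Inter>{M. maximal_left_ideal R M}"

definition left_artinian :: "('a, 'b) ring_scheme \<Rightarrow> bool" where
  "left_artinian R \<longleftrightarrow>
     (\<forall>I :: nat \<Rightarrow> 'a set. (\<forall>n. left_ideal R (I n) \<and> I (Suc n) \<subseteq> I n) \<longrightarrow>
        (\<exists>N. \<forall>n \<ge> N. I n = I N))"

text \<open>
  Semisimple in the sense of Jacobson. For a left Artinian ring this agrees with being
  semisimple as a left module over itself.
\<close>

definition semisimple_ring :: "('a, 'b) ring_scheme \<Rightarrow> bool" where
  "semisimple_ring R \<longleftrightarrow> jacobson_radical R = {\<zero>\<^bsub>R\<^esub>}"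

text \<open>
  A direct factor isomorphic to \<open>A\<close>. The complementary factor \<open>S\<close> may be the zero ring
  (\<open>ring\<close> does not require \<open>\<one> \<noteq> \<zero>\<close>). Letting \<open>S\<close> range over rings with elements in the
  type of \<open>R\<close> is no restriction, since \<open>S\<close> is in bijection with a subset of \<open>R\<close>.
\<close>

definition has_summand :: "('a, 'b) ring_scheme \<Rightarrow> ('c, 'd) ring_scheme \<Rightarrow> bool" where
  "has_summand R A \<longleftrightarrow> (\<exists>S :: 'a ring. ring S \<and> R \<simeq> RDirProd A S)"

text \<open>
  A simple graph is a pair of a vertex set and a set of two-element edges; graphs may be
  infinite.
\<close>

type_synonym 'v sgraph = "'v set \<times> 'v set set"

definition unit_graph :: "('a, 'b) ring_scheme \<Rightarrow> 'a sgraph" where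
  "unit_graph R =
     (carrier R,
      {{a, b} | a b. a \<in> carrier R \<and> b \<in> carrier R \<and> a \<noteq> b \<and> a \<oplus>\<^bsub>R\<^esub> b \<in> Units R})"

definition bipartite :: "'v sgraph \<Rightarrow> bool" where
  "bipartite G \<longleftrightarrow>
     (\<exists>V1 V2. V1 \<union> V2 = fst G \<and> V1 \<inter> V2 = {} \<and>
        (\<forall>a \<in> V1. \<forall>b \<in> V1. {a, b} \<notin> snd G) \<and>
        (\<forall>a \<in> V2. \<forall>b \<in> V2. {a, b} \<notin> snd G))"

end

theory Submission
  imports Defs
begin

text \<open>
  An element is a unit iff its image modulo the Jacobson radical is, so 2-colourings can be moved
  between \<open>R\<close> and \<open>R/J(R)\<close> as soon as no vertex satisfies \<open>2 a \<in> U(R)\<close>; if \<open>2\<close> is a unit and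
  \<open>0 \<noteq> j \<in> J(R)\<close>, then \<open>0, 1, 1 + j\<close> is a triangle.

  Let \<open>R\<close> be semisimple left Artinian with bipartite unit graph. If \<open>2\<close> is a unit, a nontrivial
  idempotent \<open>e\<close> gives the triangle \<open>e, 1, 1 - e\<close>, so \<open>R\<close> is a division ring, and any
  \<open>x \<noteq> 0, 1, -1\<close> gives the triangle \<open>0, 1, x\<close>. If \<open>2\<close> is not a unit, then \<open>1 = u + v\<close> with units
  \<open>u, v\<close> would give the triangle \<open>0, u, v\<close>. Instead of invoking Wedderburn-Artin, one takes an
  idempotent \<open>e\<close> with \<open>R (1 - e)\<close> minimal among those that are sums of two units of \<open>e R e\<close>. If
  \<open>e \<noteq> 1\<close>, pick a primitive idempotent \<open>g\<close> orthogonal to \<open>e\<close>: \<open>e\<close> can be enlarged when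
  \<open>g R g \<noteq> {0, g}\<close>, when \<open>g R (1 - e - g) \<noteq> 0\<close>, and when \<open>g R e \<noteq> 0\<close>, and otherwise \<open>g\<close> is
  central and \<open>g R = {0, g}\<close> is a summand \<open>\<int>\<^sub>2\<close>.
\<close>

subsection \<open>Maximal left ideals and the Jacobson radical\<close>

context ring
begin

lemma left_idealI:
  assumes "I \<subseteq> carrier R" "\<zero> \<in> I"
    and "\<And>a b. a \<in> I \<Longrightarrow> b \<in> I \<Longrightarrow> a \<oplus> b \<in> I"
    and mult: "\<And>x a. x \<in> carrier R \<Longrightarrow> a \<in> I \<Longrightarrow> x \<otimes> a \<in> I"
  shows "left_ideal R I"
proof -
  have "\<ominus> a \<in> I" if "a \<in> I" for a
    using mult[of "\<ominus> \<one>" a] that assms(1) by (auto simp: l_minus)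
  then have "subgroup I (add_monoid R)"
    using assms by (intro add.subgroupI) auto
  then show ?thesis
    unfolding left_ideal_def using mult by (auto intro: additive_subgroupI)
qed

lemma left_idealD:
  assumes "left_ideal R I"
  shows "I \<subseteq> carrier R" "\<zero> \<in> I"
    and "\<And>a b. a \<in> I \<Longrightarrow> b \<in> I \<Longrightarrow> a \<oplus> b \<in> I"
    and "\<And>x a. x \<in> carrier R \<Longrightarrow> a \<in> I \<Longrightarrow> x \<otimes> a \<in> I"
    and "\<And>a. a \<in> I \<Longrightarrow> \<ominus> a \<in> I"
    and "\<And>a b. a \<in> I \<Longrightarrow> b \<in> I \<Longrightarrow> a \<ominus> b \<in> I"
proof -
  interpret additive_subgroup I R
    using assms by (simp add: left_ideal_def)
  show "I \<subseteq> carrier R" "\<zero> \<in> I"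
    and "\<And>a b. a \<in> I \<Longrightarrow> b \<in> I \<Longrightarrow> a \<oplus> b \<in> I"
    and "\<And>a. a \<in> I \<Longrightarrow> \<ominus> a \<in> I"
    and "\<And>a b. a \<in> I \<Longrightarrow> b \<in> I \<Longrightarrow> a \<ominus> b \<in> I"
    by (auto simp: a_subset a_minus_def)
  show "\<And>x a. x \<in> carrier R \<Longrightarrow> a \<in> I \<Longrightarrow> x \<otimes> a \<in> I"
    using assms by (simp add: left_ideal_def)
qed

lemma left_ideal_one: "left_ideal R I \<Longrightarrow> \<one> \<in> I \<Longrightarrow> I = carrier R"
  using left_idealD(1,4)[of I] by (metis r_one subsetI subset_antisym)

lemma left_ideal_principal:
  assumes "a \<in> carrier R"
  shows "left_ideal R ((\<lambda>r. r \<otimes> a) ` carrier R)"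
proof (rule left_idealI)
  show "\<zero> \<in> (\<lambda>r. r \<otimes> a) ` carrier R"
    using assms by (intro image_eqI[of _ _ \<zero>]) auto
next
  fix x y assume "x \<in> (\<lambda>r. r \<otimes> a) ` carrier R" "y \<in> (\<lambda>r. r \<otimes> a) ` carrier R"
  then show "x \<oplus> y \<in> (\<lambda>r. r \<otimes> a) ` carrier R"
    using assms by (auto simp: l_distr[symmetric])
next
  fix x y assume "x \<in> carrier R" "y \<in> (\<lambda>r. r \<otimes> a) ` carrier R"
  then show "x \<otimes> y \<in> (\<lambda>r. r \<otimes> a) ` carrier R"
    using assms by (auto simp: m_assoc[symmetric])
qed (use assms in auto)

lemma left_ideal_sum_principal:
  assumes M: "left_ideal R M" and a: "a \<in> carrier R"
  shows "left_ideal R {m \<oplus> r \<otimes> a | m r. m \<in> M \<and> r \<in> carrier R}" (is "left_ideal R ?K")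
proof (rule left_idealI)
  note D = left_idealD[OF M]
  have sub: "m \<in> M \<Longrightarrow> m \<in> carrier R" for m using D(1) by blast
  show "?K \<subseteq> carrier R" using sub a by auto
  show "\<zero> \<in> ?K" using D(2) a by (auto intro!: exI[of _ \<zero>])
  show "x \<oplus> y \<in> ?K" if xy: "x \<in> ?K" "y \<in> ?K" for x y
  proof -
    obtain m r m' r' where "x = m \<oplus> r \<otimes> a" "y = m' \<oplus> r' \<otimes> a"
      and *: "m \<in> M" "m' \<in> M" "r \<in> carrier R" "r' \<in> carrier R"
      using xy by blast
    then have "x \<oplus> y = (m \<oplus> m') \<oplus> (r \<oplus> r') \<otimes> a"
      using a sub by (simp add: l_distr a_ac)
    then show ?thesis using * D(3) by blast
  qed
  show "x \<otimes> y \<in> ?K" if x: "x \<in> carrier R" and y: "y \<in> ?K" for x y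
  proof -
    obtain m r where "y = m \<oplus> r \<otimes> a" and *: "m \<in> M" "r \<in> carrier R"
      using y by blast
    then have "x \<otimes> y = x \<otimes> m \<oplus> (x \<otimes> r) \<otimes> a"
      using a sub x by (simp add: r_distr m_assoc)
    then show ?thesis using * D(4) x by blast
  qed
qed

lemma maximal_left_idealD:
  assumes "maximal_left_ideal R M"
  shows "left_ideal R M" "M \<noteq> carrier R"
    and "\<And>I. left_ideal R I \<Longrightarrow> M \<subseteq> I \<Longrightarrow> I = M \<or> I = carrier R"
  using assms unfolding maximal_left_ideal_def by auto

text \<open>The left ideal \<open>M + R a\<close> properly contains \<open>M\<close>, so by
  maximality it is all of \<open>R\<close>.\<close>

lemma maximal_left_ideal_sum:
  assumes M: "maximal_left_ideal R M" and a: "a \<in> carrier R" "a \<notin> M" and y: "y \<in> carrier R"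
  shows "\<exists>m \<in> M. \<exists>r \<in> carrier R. y = m \<oplus> r \<otimes> a"
proof -
  let ?K = "{m \<oplus> r \<otimes> a | m r. m \<in> M \<and> r \<in> carrier R}"
  have M': "left_ideal R M" using maximal_left_idealD(1)[OF M] .
  note D = left_idealD[OF M']
  have "M \<subseteq> ?K"
  proof
    fix m assume "m \<in> M"
    then have "m = m \<oplus> \<zero> \<otimes> a" using D(1) a by auto
    then show "m \<in> ?K" using \<open>m \<in> M\<close> by blast
  qed
  moreover have "a \<in> ?K"
    using D(2) a by (intro CollectI exI[of _ \<zero>] exI[of _ \<one>]) auto
  then have "?K \<noteq> M" using a(2) by auto
  moreover note left_ideal_sum_principal[OF M' a(1)]
  ultimately have "?K = carrier R"
    using maximal_left_idealD(3)[OF M, of ?K] by simp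
  then show ?thesis using y by blast
qed

lemma maximal_left_ideal_one:
  assumes "maximal_left_ideal R M" shows "\<one> \<notin> M"
  using assms left_ideal_one unfolding maximal_left_ideal_def by blast

text \<open>Zorn's lemma, with properness expressed by \<open>\<one> \<notin> K\<close> because this
  condition survives unions of chains.\<close>

lemma ex_maximal_left_ideal:
  assumes I: "left_ideal R I" "\<one> \<notin> I"
  shows "\<exists>M. maximal_left_ideal R M \<and> I \<subseteq> M"
proof -
  define A where "A = {K. left_ideal R K \<and> I \<subseteq> K \<and> \<one> \<notin> K}"
  have "\<exists>M\<in>A. \<forall>K\<in>A. M \<subseteq> K \<longrightarrow> K = M"
  proof (rule subset_Zorn_nonempty)
    show "A \<noteq> {}" unfolding A_def using I by blast
    fix C assume C: "C \<noteq> {}" "subset.chain A C"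
    have mem: "left_ideal R K" "I \<subseteq> K" "\<one> \<notin> K" if "K \<in> C" for K
      using C(2) that by (auto simp: subset.chain_def A_def)
    have lin: "K \<subseteq> L \<or> L \<subseteq> K" if "K \<in> C" "L \<in> C" for K L
      using C(2) that by (auto simp: subset.chain_def A_def)
    have "left_ideal R (\<Union>C)"
    proof (rule left_idealI)
      show "\<Union>C \<subseteq> carrier R" "\<zero> \<in> \<Union>C"
        using left_idealD(1,2)[OF mem(1)] C(1) by blast+
      show "a \<oplus> b \<in> \<Union>C" if ab: "a \<in> \<Union>C" "b \<in> \<Union>C" for a b
      proof -
        from ab obtain K L where "K \<in> C" "L \<in> C" "a \<in> K" "b \<in> L" by blast
        then show ?thesis
          using lin[of K L] left_idealD(3)[OF mem(1), of K a b] left_idealD(3)[OF mem(1), of L a b]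
          by blast
      qed
      show "x \<otimes> a \<in> \<Union>C" if "x \<in> carrier R" "a \<in> \<Union>C" for x a
        using that left_idealD(4)[OF mem(1)] by blast
    qed
    then show "\<Union>C \<in> A" unfolding A_def using mem C(1) by blast
  qed
  then obtain M where M: "left_ideal R M" "I \<subseteq> M" "\<one> \<notin> M"
    and max: "\<forall>K\<in>A. M \<subseteq> K \<longrightarrow> K = M"
    unfolding A_def by auto
  have "K = M \<or> K = carrier R" if K: "left_ideal R K" "M \<subseteq> K" for K
  proof (cases "\<one> \<in> K")
    case True
    then show ?thesis using left_ideal_one[OF K(1)] by simp
  next
    case False
    then have "K \<in> A" using K M unfolding A_def by simp
    then show ?thesis using max K(2) by simp
  qed
  moreover have "M \<noteq> carrier R" using M(3) by auto
  ultimately have "maximal_left_ideal R M"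
    unfolding maximal_left_ideal_def using M(1) by simp
  then show ?thesis using M(2) by auto
qed

lemma left_ideal_jacobson: "left_ideal R (jacobson_radical R)"
proof -
  have "\<And>M. maximal_left_ideal R M \<Longrightarrow> left_ideal R M"
    by (simp add: maximal_left_ideal_def)
  note D = left_idealD[OF this]
  show ?thesis
    unfolding jacobson_radical_def by (rule left_idealI) (use D in auto)
qed

text \<open>
  If \<open>x \<notin> M\<close> then \<open>(M : x)\<close> is the annihilator of \<open>x + M\<close> in the simple module \<open>R/M\<close>.
\<close>

lemma maximal_left_ideal_colon:
  assumes M: "maximal_left_ideal R M" and x: "x \<in> carrier R" "x \<notin> M"
  shows "maximal_left_ideal R {a \<in> carrier R. a \<otimes> x \<in> M}" (is "maximal_left_ideal R ?N")
proof -
  have M': "left_ideal R M" using maximal_left_idealD(1)[OF M] .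
  note D = left_idealD[OF M']
  have N: "left_ideal R ?N"
    by (rule left_idealI) (use D x in \<open>auto simp: l_distr m_assoc\<close>)
  moreover have "\<one> \<notin> ?N" using x by simp
  then have "?N \<noteq> carrier R" by auto
  moreover have "I = ?N \<or> I = carrier R" if I: "left_ideal R I" "?N \<subseteq> I" for I
  proof (cases "I = ?N")
    case False
    then obtain i where i: "i \<in> I" "i \<in> carrier R" "i \<otimes> x \<notin> M"
      using I(2) left_idealD(1)[OF I(1)] by blast
    \<comment> \<open>As \<open>i x\<close> is outside \<open>M\<close>, the element
      \<open>x\<close> lies in \<open>M + R i x\<close>. Rearranged, \<open>(1 - s i) x\<close> is
      in \<open>M\<close>, so \<open>1 - s i\<close> is in the colon ideal and hence in
      \<open>I\<close>. Since \<open>s i\<close> is in \<open>I\<close> too, so is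
      \<open>1\<close>.\<close>
    then obtain m s where ms: "m \<in> M" "s \<in> carrier R" "x = m \<oplus> s \<otimes> (i \<otimes> x)"
      using maximal_left_ideal_sum[OF M m_closed[OF i(2) x(1)] i(3) x(1)] by blast
    then have mc: "m \<in> carrier R" using D(1) by blast
    have "(\<one> \<ominus> (s \<otimes> i)) \<otimes> x = (m \<oplus> s \<otimes> (i \<otimes> x)) \<ominus> s \<otimes> (i \<otimes> x)"
      using ms(2) i(2) x(1) by (subst ms(3)[symmetric]) algebra
    also have "\<dots> = m"
      using ms(2) i(2) x(1) mc by algebra
    finally have "\<one> \<ominus> s \<otimes> i \<in> I" using ms(1,2) i(2) I(2) by auto
    moreover have "s \<otimes> i \<in> I" using left_idealD(4)[OF I(1)] i ms by blast
    ultimately have "(\<one> \<ominus> s \<otimes> i) \<oplus> s \<otimes> i \<in> I" using left_idealD(3)[OF I(1)] by blast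
    also have "(\<one> \<ominus> s \<otimes> i) \<oplus> s \<otimes> i = \<one>" using ms(2) i(2) by algebra
    finally show ?thesis using left_ideal_one I by blast
  qed simp
  ultimately show ?thesis unfolding maximal_left_ideal_def by auto
qed

text \<open>Only closure under right multiplication needs an argument. If \<open>x\<close> is
  outside \<open>M\<close>, then \<open>(M : x)\<close> is again a maximal left ideal, so it
  contains every \<open>a\<close> in the radical, which means \<open>a x\<close> is in
  \<open>M\<close>.\<close>

lemma ideal_jacobson: "ideal (jacobson_radical R) R"
proof (rule idealI)
  let ?J = "jacobson_radical R"
  note D = left_idealD[OF left_ideal_jacobson]
  show "ring R" by (rule ring_axioms)
  show "subgroup ?J (add_monoid R)"
    using left_ideal_jacobson by (simp add: left_ideal_def additive_subgroup.a_subgroup)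
  show "x \<otimes> a \<in> ?J" if "a \<in> ?J" "x \<in> carrier R" for a x
    using D(4) that by blast
  show "a \<otimes> x \<in> ?J" if a: "a \<in> ?J" and x: "x \<in> carrier R" for a x
  proof -
    have ac: "a \<in> carrier R" using D(1) a by blast
    have "a \<otimes> x \<in> M" if M: "maximal_left_ideal R M" for M
    proof (cases "x \<in> M")
      case True
      have "left_ideal R M" using maximal_left_idealD(1)[OF M] .
      then show ?thesis using left_idealD(4)[of M a x] True ac by blast
    next
      case False
      from maximal_left_ideal_colon[OF M x this] a
      show ?thesis unfolding jacobson_radical_def by blast
    qed
    then show ?thesis using ac x by (auto simp: jacobson_radical_def)
  qed
qed

text \<open>If \<open>R (1 + j)\<close> were proper, a maximal left ideal above it would contain
  both \<open>1 + j\<close> and \<open>j\<close>, hence \<open>1\<close>.\<close>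

lemma jacobson_left_inverse:
  assumes j: "j \<in> jacobson_radical R"
  shows "\<exists>s \<in> carrier R. s \<otimes> (\<one> \<oplus> j) = \<one>"
proof (rule ccontr)
  assume neg: "\<not> ?thesis"
  have jc: "j \<in> carrier R" using j by (simp add: jacobson_radical_def)
  let ?K = "(\<lambda>r. r \<otimes> (\<one> \<oplus> j)) ` carrier R"
  have "\<one> \<notin> ?K" using neg by force
  then obtain M where M: "maximal_left_ideal R M" "?K \<subseteq> M"
    using ex_maximal_left_ideal[OF left_ideal_principal] jc by blast
  have "j \<in> M" using j M(1) by (auto simp: jacobson_radical_def)
  moreover have "\<one> \<oplus> j \<in> ?K" using jc by (intro image_eqI[of _ _ \<one>]) auto
  then have "\<one> \<oplus> j \<in> M" using M by blast
  ultimately have "(\<one> \<oplus> j) \<ominus> j \<in> M"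
    using left_idealD(6) M(1) unfolding maximal_left_ideal_def by blast
  also have "(\<one> \<oplus> j) \<ominus> j = \<one>" using jc by algebra
  finally show False using maximal_left_ideal_one M(1) by blast
qed

section \<open>Units modulo the Jacobson radical\<close>

lemma UnitsI:
  "x \<in> carrier R \<Longrightarrow> y \<in> carrier R \<Longrightarrow> y \<otimes> x = \<one> \<Longrightarrow> x \<otimes> y = \<one> \<Longrightarrow> x \<in> Units R"
  by (auto simp: Units_def)

text \<open>The left inverse \<open>s\<close> of \<open>1 + j\<close> equals \<open>1 - s j\<close>,
  which again has the form \<open>1\<close> plus an element of the radical. So \<open>s\<close> has
  a left inverse as well, and this must be \<open>1 + j\<close>, which makes \<open>s\<close> a
  two-sided inverse.\<close>

lemma one_plus_jacobson_Units:
  assumes j: "j \<in> jacobson_radical R"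
  shows "\<one> \<oplus> j \<in> Units R"
proof -
  note D = left_idealD[OF left_ideal_jacobson]
  have jc: "j \<in> carrier R" using j D(1) by blast
  obtain s where s: "s \<in> carrier R" "s \<otimes> (\<one> \<oplus> j) = \<one>"
    using jacobson_left_inverse[OF j] by blast
  have "\<one> \<oplus> \<ominus> (s \<otimes> j) = s \<otimes> (\<one> \<oplus> j) \<oplus> \<ominus> (s \<otimes> j)" using s by simp
  also have "\<dots> = s" using s(1) jc by (simp add: r_distr a_assoc r_neg)
  finally have "\<one> \<oplus> \<ominus> (s \<otimes> j) = s" .
  moreover have "\<ominus> (s \<otimes> j) \<in> jacobson_radical R" using D(4,5) s j by blast
  ultimately obtain t where t: "t \<in> carrier R" "t \<otimes> s = \<one>"
    using jacobson_left_inverse by metis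
  have "t = t \<otimes> (s \<otimes> (\<one> \<oplus> j))" using s t by simp
  also have "\<dots> = \<one> \<oplus> j" using s(1) t jc by (simp add: m_assoc[symmetric])
  finally show ?thesis using UnitsI s t jc by force
qed

text \<open>The two unit products supply a left inverse and a right inverse of \<open>x\<close>, and
  by associativity these coincide.\<close>

lemma Units_of_left_right:
  assumes "x \<in> carrier R" "y \<in> carrier R" "z \<in> carrier R" "y \<otimes> x \<in> Units R" "x \<otimes> z \<in> Units R"
  shows "x \<in> Units R"
proof -
  let ?l = "inv (y \<otimes> x) \<otimes> y" and ?r = "z \<otimes> inv (x \<otimes> z)"
  have l: "?l \<otimes> x = \<one>" using assms by (simp add: m_assoc)
  have r: "x \<otimes> ?r = \<one>" using assms by (simp add: m_assoc[symmetric])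
  have c: "?l \<in> carrier R" "?r \<in> carrier R" using assms by auto
  have "?l = ?l \<otimes> (x \<otimes> ?r)" unfolding r using c by simp
  also have "\<dots> = (?l \<otimes> x) \<otimes> ?r" using c assms(1) by (intro m_assoc[symmetric])
  also have "\<dots> = ?r" unfolding l using c by simp
  finally show ?thesis using UnitsI[OF assms(1) c(1) l] r by simp
qed

text \<open>The coset of \<open>1\<close> consists of elements \<open>1 + j\<close> with
  \<open>j\<close> in the radical, all of them units. If \<open>y\<close> represents the inverse of
  the coset of \<open>x\<close>, then \<open>y x\<close> and \<open>x y\<close> are in that coset,
  so \<open>x\<close> is invertible from both sides.\<close>

lemma Units_quotient_jacobson_iff:
  assumes x: "x \<in> carrier R"
  defines "J \<equiv> jacobson_radical R"
  shows "J +> x \<in> Units (R Quot J) \<longleftrightarrow> x \<in> Units R"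
proof -
  interpret J: ideal J R unfolding J_def by (rule ideal_jacobson)
  interpret h: ring_hom_ring R "R Quot J" "(+>) J" by (rule J.rcos_ring_hom_ring)
  have carr: "carrier (R Quot J) = ((+>) J) ` carrier R"
    unfolding FactRing_def A_RCOSETS_def' by (simp add: UNION_singleton_eq_range)
  have lift: "a \<in> Units R" if a: "a \<in> carrier R" "J +> a = \<one>\<^bsub>R Quot J\<^esub>" for a
  proof -
    have "J +> a = J +> \<one>" using a by simp
    then have "a \<ominus> \<one> \<in> J" using quotient_eq_iff_same_a_r_cos[OF J.ideal_axioms, of a \<one>] a by simp
    then have "\<one> \<oplus> (a \<ominus> \<one>) \<in> Units R" using one_plus_jacobson_Units unfolding J_def by blast
    also have "\<one> \<oplus> (a \<ominus> \<one>) = a" using a by algebra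
    finally show ?thesis .
  qed
  show ?thesis
  proof
    assume "J +> x \<in> Units (R Quot J)"
    then obtain y where y: "y \<in> carrier R"
      "(J +> y) \<otimes>\<^bsub>R Quot J\<^esub> (J +> x) = \<one>\<^bsub>R Quot J\<^esub>" "(J +> x) \<otimes>\<^bsub>R Quot J\<^esub> (J +> y) = \<one>\<^bsub>R Quot J\<^esub>"
      unfolding Units_def carr by auto
    then show "x \<in> Units R"
      using Units_of_left_right[of x y y] x lift by simp
  next
    assume u: "x \<in> Units R"
    then have "(J +> inv x) \<otimes>\<^bsub>R Quot J\<^esub> (J +> x) = \<one>\<^bsub>R Quot J\<^esub>"
        "(J +> x) \<otimes>\<^bsub>R Quot J\<^esub> (J +> inv x) = \<one>\<^bsub>R Quot J\<^esub>"
      by (simp_all flip: h.hom_mult add: x)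
    moreover have "J +> inv x \<in> carrier (R Quot J)" "J +> x \<in> carrier (R Quot J)"
      using u x by (simp_all del: h.hom_closed add: carr)
    ultimately show "J +> x \<in> Units (R Quot J)"
      unfolding Units_def by blast
  qed
qed

end

subsection \<open>Colourings of unit graphs\<close>

lemma (in ring) unit_graph_edge_iff:
  "{a, b} \<in> snd (unit_graph R) \<longleftrightarrow>
     a \<in> carrier R \<and> b \<in> carrier R \<and> a \<noteq> b \<and> a \<oplus> b \<in> Units R"
  unfolding unit_graph_def by (auto simp: doubleton_eq_iff a_comm)

lemma bipartite_unit_graphD:
  fixes R :: "('a, 'b) ring_scheme" (structure)
  assumes "ring R" "bipartite (unit_graph R)"
  shows "\<exists>c :: 'a \<Rightarrow> bool. \<forall>a \<in> carrier R. \<forall>b \<in> carrier R. a \<noteq> b \<longrightarrow> a \<oplus> b \<in> Units R \<longrightarrow> c a \<noteq> c b"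
proof -
  interpret ring R by fact
  from assms(2) obtain V1 V2 where V: "V1 \<union> V2 = carrier R"
      "\<forall>a\<in>V1. \<forall>b\<in>V1. {a, b} \<notin> snd (unit_graph R)" "\<forall>a\<in>V2. \<forall>b\<in>V2. {a, b} \<notin> snd (unit_graph R)"
    unfolding bipartite_def by (auto simp: unit_graph_def)
  have "(a \<in> V1) \<noteq> (b \<in> V1)"
    if "a \<in> carrier R" "b \<in> carrier R" "a \<noteq> b" "a \<oplus> b \<in> Units R" for a b
    using V(2,3)[rule_format, of a b] that V(1) unfolding unit_graph_edge_iff by blast
  then show ?thesis by (intro exI[of _ "\<lambda>a. a \<in> V1"]) simp
qed

lemma bipartite_unit_graphI:
  fixes R :: "('a, 'b) ring_scheme" (structure) and c :: "'a \<Rightarrow> bool"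
  assumes "ring R"
    and "\<And>a b. a \<in> carrier R \<Longrightarrow> b \<in> carrier R \<Longrightarrow> a \<noteq> b \<Longrightarrow> a \<oplus> b \<in> Units R \<Longrightarrow> c a \<noteq> c b"
  shows "bipartite (unit_graph R)"
  unfolding bipartite_def
proof (intro exI conjI)
  show "{a \<in> carrier R. c a} \<union> {a \<in> carrier R. \<not> c a} = fst (unit_graph R)"
    by (auto simp: unit_graph_def)
qed (use assms(2) in \<open>auto simp: ring.unit_graph_edge_iff[OF assms(1)]\<close>)

context ring
begin

section \<open>Triangles in the unit graph, and colourings modulo the radical\<close>

lemma not_bipartite_triangle:
  assumes "a \<in> carrier R" "b \<in> carrier R" "d \<in> carrier R" "a \<noteq> b" "b \<noteq> d" "a \<noteq> d"
    and "a \<oplus> b \<in> Units R" "b \<oplus> d \<in> Units R" "a \<oplus> d \<in> Units R"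
  shows "\<not> bipartite (unit_graph R)"
proof
  assume "bipartite (unit_graph R)"
  from bipartite_unit_graphD[OF ring_axioms this] obtain c :: "'a \<Rightarrow> bool" where
    c: "\<forall>a \<in> carrier R. \<forall>b \<in> carrier R. a \<noteq> b \<longrightarrow> a \<oplus> b \<in> Units R \<longrightarrow> c a \<noteq> c b" ..
  from c[rule_format, of a b] c[rule_format, of b d] c[rule_format, of a d] show False
    using assms by simp
qed

lemma zero_neq_Units:
  assumes "\<one> \<noteq> \<zero>" "u \<in> Units R" shows "\<zero> \<noteq> u"
proof
  assume "\<zero> = u"
  then have "\<one> = \<zero> \<otimes> inv u" using assms(2) by simp
  then show False using assms by simp
qed

lemma not_bipartite_if_two_unit_jacobson:
  assumes nz: "\<one> \<noteq> \<zero>" and J: "jacobson_radical R \<noteq> {\<zero>}" and two: "\<one> \<oplus> \<one> \<in> Units R"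
  shows "\<not> bipartite (unit_graph R)"
proof -
  note D = left_idealD[OF left_ideal_jacobson]
  obtain j where j: "j \<in> jacobson_radical R" "j \<noteq> \<zero>" using J D(2) by blast
  then have jc: "j \<in> carrier R" using D(1) by blast
  \<comment> \<open>The edge from \<open>1\<close> to \<open>1 + j\<close> needs
    \<open>2 + j\<close> to be a unit. With \<open>?h\<close> as one half,
    \<open>2 + j = 2 (1 + ?h j)\<close>, and \<open>?h j\<close> is still in the radical.\<close>
  let ?h = "inv (\<one> \<oplus> \<one>)"
  have "?h \<otimes> j \<in> jacobson_radical R" using D(4) j two by simp
  then have "(\<one> \<oplus> \<one>) \<otimes> (\<one> \<oplus> ?h \<otimes> j) \<in> Units R"
    using one_plus_jacobson_Units two by blast
  also have "(\<one> \<oplus> \<one>) \<otimes> (\<one> \<oplus> ?h \<otimes> j) = (\<one> \<oplus> \<one>) \<oplus> ((\<one> \<oplus> \<one>) \<otimes> ?h) \<otimes> j"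
    using two jc by (simp only: r_distr m_assoc Units_closed Units_inv_closed m_closed one_closed r_one)
  also have "\<dots> = \<one> \<oplus> (\<one> \<oplus> j)" using two jc by (simp add: a_assoc)
  finally have "\<one> \<oplus> (\<one> \<oplus> j) \<in> Units R" .
  moreover have "\<one> \<oplus> j \<in> Units R" using j one_plus_jacobson_Units by blast
  moreover have "\<one> \<noteq> \<one> \<oplus> j"
    using j(2) jc add.r_cancel_one'[of \<one> j] by simp
  ultimately show ?thesis
    using not_bipartite_triangle[of \<zero> \<one> "\<one> \<oplus> j"] zero_neq_Units[OF nz] jc by auto
qed

text \<open>Since \<open>2\<close> is central, \<open>a + a\<close> equals both \<open>a 2\<close>
  and \<open>2 a\<close>; if it is a unit, then \<open>2\<close> is invertible from both sides. This
  keeps two vertices with unit sum from being congruent modulo the radical.\<close>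

lemma double_not_Units:
  assumes two: "\<one> \<oplus> \<one> \<notin> Units R" and a: "a \<in> carrier R"
  shows "a \<oplus> a \<notin> Units R"
proof
  assume u: "a \<oplus> a \<in> Units R"
  have l: "a \<oplus> a = a \<otimes> (\<one> \<oplus> \<one>)" and r: "a \<oplus> a = (\<one> \<oplus> \<one>) \<otimes> a"
    using a by (simp_all add: l_distr r_distr)
  have "\<one> \<oplus> \<one> \<in> Units R"
    by (rule Units_of_left_right[of _ a a]) (use a u in \<open>simp_all flip: l r\<close>)
  then show False using two by contradiction
qed

lemma bipartite_quotient_jacobson_iff:
  assumes two: "\<one> \<oplus> \<one> \<notin> Units R"
  defines "J \<equiv> jacobson_radical R"
  shows "bipartite (unit_graph R) \<longleftrightarrow> bipartite (unit_graph (R Quot J))"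
proof -
  interpret J: ideal J R unfolding J_def by (rule ideal_jacobson)
  interpret h: ring_hom_ring R "R Quot J" "(+>) J" by (rule J.rcos_ring_hom_ring)
  note U = Units_quotient_jacobson_iff[folded J_def]
  have carr: "carrier (R Quot J) = ((+>) J) ` carrier R"
    unfolding FactRing_def A_RCOSETS_def' by (simp add: UNION_singleton_eq_range)
  show ?thesis
  proof
    assume "bipartite (unit_graph R)"
    from bipartite_unit_graphD[OF ring_axioms this] obtain c :: "'a \<Rightarrow> bool" where
      c: "\<forall>a \<in> carrier R. \<forall>b \<in> carrier R. a \<noteq> b \<longrightarrow> a \<oplus> b \<in> Units R \<longrightarrow> c a \<noteq> c b" ..
    \<comment> \<open>A coset gets the colour of a chosen representative. Distinct cosets have
      distinct representatives, and a unit sum of cosets comes from a unit sum of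
      representatives.\<close>
    define s where "s = (\<lambda>A. SOME a. a \<in> carrier R \<and> J +> a = A)"
    have s: "s A \<in> carrier R" "J +> s A = A" if "A \<in> carrier (R Quot J)" for A
      using that someI_ex[of "\<lambda>a. a \<in> carrier R \<and> J +> a = A"] unfolding s_def carr by auto
    have "c (s A) \<noteq> c (s B)"
      if AB: "A \<in> carrier (R Quot J)" "B \<in> carrier (R Quot J)" "A \<noteq> B"
        "A \<oplus>\<^bsub>R Quot J\<^esub> B \<in> Units (R Quot J)" for A B
    proof (rule c[rule_format])
      show "s A \<noteq> s B" using AB s by metis
      have "J +> (s A \<oplus> s B) \<in> Units (R Quot J)" using AB s by simp
      then show "s A \<oplus> s B \<in> Units R" by (subst (asm) U) (use AB s in auto)
    qed (use AB s in auto)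
    then show "bipartite (unit_graph (R Quot J))"
      by (rule bipartite_unit_graphI[OF J.quotient_is_ring])
  next
    assume "bipartite (unit_graph (R Quot J))"
    from bipartite_unit_graphD[OF J.quotient_is_ring this] obtain c :: "'a set \<Rightarrow> bool" where
      c: "\<forall>A \<in> carrier (R Quot J). \<forall>B \<in> carrier (R Quot J).
        A \<noteq> B \<longrightarrow> A \<oplus>\<^bsub>R Quot J\<^esub> B \<in> Units (R Quot J) \<longrightarrow> c A \<noteq> c B" ..
    have "c (J +> a) \<noteq> c (J +> b)"
      if ab: "a \<in> carrier R" "b \<in> carrier R" "a \<oplus> b \<in> Units R" for a b
    proof (rule c[rule_format])
      have u: "J +> (a \<oplus> b) \<in> Units (R Quot J)" by (subst U) (use ab in auto)
      then show "(J +> a) \<oplus>\<^bsub>R Quot J\<^esub> (J +> b) \<in> Units (R Quot J)" using ab by simp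
      \<comment> \<open>The pulled-back colouring could fail only on adjacent vertices in the same
        coset. Then \<open>a + b\<close> and \<open>a + a\<close> would be congruent, so
        \<open>a + a\<close> would be a unit; here the hypothesis on \<open>2\<close>
        enters.\<close>
      show "J +> a \<noteq> J +> b"
      proof
        assume "J +> a = J +> b"
        then have "J +> (a \<oplus> a) \<in> Units (R Quot J)" using u ab by simp
        then have "a \<oplus> a \<in> Units R" by (subst (asm) U) (use ab in auto)
        then show False using ab double_not_Units[OF two] by simp
      qed
    qed (use ab in auto)
    then show "bipartite (unit_graph R)"
      by (intro bipartite_unit_graphI[OF ring_axioms])
  qed
qed

end

subsection \<open>Primitive idempotents in semisimple left Artinian rings\<close>

text \<open>The last condition says that \<open>R g\<close> is a minimal left ideal.\<close>

definition (in ring) primitive :: "'a \<Rightarrow> bool" where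
  "primitive g \<longleftrightarrow> g \<in> carrier R \<and> g \<otimes> g = g \<and> g \<noteq> \<zero> \<and>
     (\<forall>x \<in> carrier R. x \<otimes> g \<noteq> \<zero> \<longrightarrow> (\<exists>r \<in> carrier R. r \<otimes> (x \<otimes> g) = g))"

locale semisimple_artinian_ring = ring R for R (structure) +
  assumes jacobson_zero: "jacobson_radical R = {\<zero>}"
    and artinian: "left_artinian R"
begin

text \<open>If \<open>a\<close> is outside a maximal left ideal \<open>M\<close>, write
  \<open>1 = m + r a\<close> and multiply by \<open>r a\<close> on the left. As
  \<open>(r a) (r a) = 0\<close>, this gives \<open>r a = r a m\<close> in \<open>M\<close>, hence
  \<open>1\<close> in \<open>M\<close>. So \<open>a\<close> lies in every maximal left ideal, that
  is, in the zero radical.\<close>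

lemma semiprime:
  assumes a: "a \<in> carrier R" and z: "\<And>r. r \<in> carrier R \<Longrightarrow> a \<otimes> r \<otimes> a = \<zero>"
  shows "a = \<zero>"
proof -
  have "a \<in> M" if M: "maximal_left_ideal R M" for M
  proof (rule ccontr)
    assume "a \<notin> M"
    then obtain m r where mr: "m \<in> M" "r \<in> carrier R" "\<one> = m \<oplus> r \<otimes> a"
      using maximal_left_ideal_sum[OF M a _ one_closed] by blast
    note D = left_idealD[OF maximal_left_idealD(1)[OF M]]
    have mc: "m \<in> carrier R" using D(1) mr(1) by blast
    have "r \<otimes> a = (r \<otimes> a) \<otimes> (m \<oplus> r \<otimes> a)" unfolding mr(3)[symmetric] using mr(2) a by simp
    also have "\<dots> = (r \<otimes> a) \<otimes> m \<oplus> r \<otimes> (a \<otimes> r \<otimes> a)" using mr(2) a mc by algebra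
    also have "\<dots> = (r \<otimes> a) \<otimes> m" using mr(2) a mc z by simp
    finally have "r \<otimes> a \<in> M" using D(4) mr(1,2) a by (metis m_closed)
    then have "\<one> \<in> M" using D(3) mr(1,3) by metis
    then show False using maximal_left_ideal_one[OF M] by simp
  qed
  then have "a \<in> jacobson_radical R" using a by (simp add: jacobson_radical_def)
  then show ?thesis using jacobson_zero by simp
qed

text \<open>Without a minimal member, iterating a choice of strictly smaller members would yield a
  chain that never becomes stationary.\<close>

lemma minimal_left_ideal_in:
  assumes S: "S \<noteq> {}" "\<And>I. I \<in> S \<Longrightarrow> left_ideal R I"
  shows "\<exists>L \<in> S. \<forall>I \<in> S. I \<subseteq> L \<longrightarrow> I = L"
proof (rule ccontr)
  assume "\<not> ?thesis"
  then have "\<forall>L \<in> S. \<exists>I. I \<in> S \<and> I \<subset> L" by blast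
  then obtain f where f: "\<And>L. L \<in> S \<Longrightarrow> f L \<in> S \<and> f L \<subset> L" by metis
  obtain L0 where "L0 \<in> S" using S(1) by blast
  then have mem: "(f ^^ n) L0 \<in> S" for n by (induction n) (auto simp: f)
  then have "left_ideal R ((f ^^ n) L0) \<and> (f ^^ Suc n) L0 \<subset> (f ^^ n) L0" for n
    using S(2) f by simp
  then obtain N where "\<forall>n\<ge>N. (f ^^ n) L0 = (f ^^ N) L0"
    using artinian[unfolded left_artinian_def, rule_format, of "\<lambda>n. (f ^^ n) L0"] by blast
  then have "(f ^^ Suc N) L0 = (f ^^ N) L0" by (meson le_SucI order_refl)
  then show False using f[OF mem[of N]] by simp
qed

text \<open>The chain of the \<open>R a^n\<close> becomes stationary, so
  \<open>a^N = r a^(N+1)\<close>, and cancelling \<open>a^N\<close> on the right gives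
  \<open>r a = 1\<close>. Then \<open>(a r - 1) a = 0\<close> gives \<open>a r = 1\<close>. Later
  unit claims are thereby reduced to showing that \<open>r a = 0\<close> forces
  \<open>r = 0\<close>.\<close>

lemma Units_if_right_regular:
  assumes a: "a \<in> carrier R" and reg: "\<And>r. r \<in> carrier R \<Longrightarrow> r \<otimes> a = \<zero> \<Longrightarrow> r = \<zero>"
  shows "a \<in> Units R"
proof -
  let ?I = "\<lambda>n::nat. (\<lambda>r. r \<otimes> a [^] n) ` carrier R"
  have "left_ideal R (?I n) \<and> ?I (Suc n) \<subseteq> ?I n" for n
  proof
    show "left_ideal R (?I n)" using left_ideal_principal a by simp
    show "?I (Suc n) \<subseteq> ?I n"
    proof (clarify)
      fix r assume r: "r \<in> carrier R"
      have "r \<otimes> a [^] Suc n = (r \<otimes> a) \<otimes> a [^] n"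
        using a r nat_pow_Suc2[OF a] by (simp add: m_assoc del: nat_pow_Suc)
      then show "r \<otimes> a [^] Suc n \<in> ?I n" using a r by blast
    qed
  qed
  then obtain N where N: "\<forall>n\<ge>N. ?I n = ?I N"
    using artinian[unfolded left_artinian_def, rule_format, of ?I] by blast
  have "a [^] N \<in> ?I N" using a by (intro image_eqI[of _ _ \<one>]) auto
  then have "a [^] N \<in> ?I (Suc N)" using N[rule_format, of "Suc N"] by simp
  then obtain r where r: "r \<in> carrier R" "a [^] N = r \<otimes> a [^] Suc N" by blast
  have pow: "x = \<zero>" if "x \<in> carrier R" "x \<otimes> a [^] n = \<zero>" for x and n :: nat
    using that
  proof (induction n arbitrary: x)
    case (Suc n)
    from Suc.prems have "x \<otimes> a [^] n \<otimes> a = \<zero>" using a by (simp add: m_assoc)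
    then have "x \<otimes> a [^] n = \<zero>" by (rule reg[rotated]) (use Suc.prems(1) a in simp)
    then show ?case by (rule Suc.IH[OF Suc.prems(1)])
  qed simp
  have "r \<otimes> a [^] Suc N = (r \<otimes> a) \<otimes> a [^] N"
    using a r(1) nat_pow_Suc2[OF a] by (simp add: m_assoc del: nat_pow_Suc)
  then have "(\<one> \<ominus> r \<otimes> a) \<otimes> a [^] N = a [^] N \<ominus> r \<otimes> a [^] Suc N"
    using a r(1) by (simp add: minus_eq l_distr l_minus del: nat_pow_Suc)
  also have "\<dots> = \<zero>"
    unfolding r(2)[symmetric] using a by (simp add: minus_eq r_neg)
  finally have "\<one> \<ominus> r \<otimes> a = \<zero>" by (rule pow[rotated]) (use a r(1) in auto)
  then have ra: "r \<otimes> a = \<one>" using a r(1) by (metis m_closed one_closed r_right_minus_eq)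
  have "(a \<otimes> r \<ominus> \<one>) \<otimes> a = a \<otimes> (r \<otimes> a) \<ominus> a" using a r(1) by algebra
  also have "\<dots> = \<zero>" using a by (simp add: ra minus_eq r_neg)
  finally have "a \<otimes> r \<ominus> \<one> = \<zero>" by (rule reg[rotated]) (use a r(1) in auto)
  then have "a \<otimes> r = \<one>" using a r(1) by (metis m_closed one_closed r_right_minus_eq)
  then show ?thesis using UnitsI a r(1) ra by blast
qed

text \<open>Brauer's argument. In a minimal nonzero left ideal \<open>L\<close> inside
  \<open>R f\<close>, semiprimeness gives \<open>b\<close> in \<open>L\<close> with
  \<open>L b\<close> nonzero. Minimality yields \<open>L b = L\<close>, so \<open>c b = b\<close>
  for some \<open>c\<close> in \<open>L\<close>, and also shows that no nonzero element of
  \<open>L\<close> kills \<open>b\<close> from the left. Since \<open>c c - c\<close> does,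
  \<open>c\<close> is idempotent.\<close>

lemma ex_primitive:
  assumes f: "f \<in> carrier R" "f \<otimes> f = f" "f \<noteq> \<zero>"
  shows "\<exists>g. primitive g \<and> f \<otimes> g = g \<and> g \<otimes> f = g"
proof -
  let ?F = "(\<lambda>r. r \<otimes> f) ` carrier R"
  define S where "S = {I. left_ideal R I \<and> I \<subseteq> ?F \<and> I \<noteq> {\<zero>}}"
  have "f \<in> ?F" using f by (intro image_eqI[of _ _ f]) auto
  then have "?F \<in> S" unfolding S_def using left_ideal_principal[OF f(1)] f(3) by auto
  then have "S \<noteq> {}" by auto
  moreover have "\<And>I. I \<in> S \<Longrightarrow> left_ideal R I" by (simp add: S_def)
  ultimately obtain L where L: "L \<in> S" and "\<forall>I \<in> S. I \<subseteq> L \<longrightarrow> I = L"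
    using minimal_left_ideal_in by meson
  then have min: "I = L" if "I \<in> S" "I \<subseteq> L" for I using that by simp
  have LI: "left_ideal R L" and LF: "L \<subseteq> ?F" and L0: "L \<noteq> {\<zero>}" using L by (auto simp: S_def)
  note D = left_idealD[OF LI]
  have Lc: "x \<in> carrier R" if "x \<in> L" for x using D(1) that by blast
  have min': "I = L" if "left_ideal R I" "I \<subseteq> L" "x \<in> I" "x \<noteq> \<zero>" for I x
    by (rule min) (use that LF in \<open>auto simp: S_def\<close>)
  obtain a where a: "a \<in> L" "a \<noteq> \<zero>" using L0 D(2) by blast
  then obtain r where r: "r \<in> carrier R" "a \<otimes> r \<otimes> a \<noteq> \<zero>" using semiprime Lc by blast
  define b where "b = r \<otimes> a"
  have b: "b \<in> L" "a \<otimes> b \<noteq> \<zero>" using D(4) r a Lc by (auto simp: b_def m_assoc)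
  have bc: "b \<in> carrier R" using b Lc by blast
  let ?Lb = "(\<lambda>x. x \<otimes> b) ` L"
  have "left_ideal R ?Lb"
  proof (rule left_idealI)
    show "?Lb \<subseteq> carrier R" using Lc bc by auto
    show "\<zero> \<in> ?Lb" using D(2) bc by (intro image_eqI[of _ _ \<zero>]) auto
    show "x \<oplus> y \<in> ?Lb" if "x \<in> ?Lb" "y \<in> ?Lb" for x y
      using that D(3) Lc bc by (auto simp: l_distr[symmetric])
    show "x \<otimes> y \<in> ?Lb" if "x \<in> carrier R" "y \<in> ?Lb" for x y
      using that D(4) Lc bc by (auto simp: m_assoc[symmetric])
  qed
  moreover have "?Lb \<subseteq> L" using D(4) b Lc by auto
  moreover have "a \<otimes> b \<in> ?Lb" using a by blast
  ultimately have "?Lb = L" using b min' by blast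
  then obtain c where c: "c \<in> L" "c \<otimes> b = b" using b by (metis imageE)
  have cc: "c \<in> carrier R" using c Lc by blast
  let ?K = "{x \<in> L. x \<otimes> b = \<zero>}"
  have K: "left_ideal R ?K"
    by (rule left_idealI) (use D Lc bc in \<open>auto simp: l_distr m_assoc\<close>)
  have K0: "x = \<zero>" if "x \<in> ?K" for x
  proof (rule ccontr)
    assume "x \<noteq> \<zero>"
    with min'[OF K _ that] have "?K = L" by auto
    then show False using a b by blast
  qed
  have "(c \<otimes> c \<ominus> c) \<otimes> b = c \<otimes> (c \<otimes> b) \<ominus> c \<otimes> b" using cc bc by algebra
  also have "\<dots> = \<zero>" using cc bc by (simp add: c minus_eq r_neg)
  finally have "c \<otimes> c \<ominus> c \<in> ?K" using D(4,6) c(1) cc by simp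
  then have "c \<otimes> c \<ominus> c = \<zero>" by (rule K0)
  then have idem: "c \<otimes> c = c" using cc by (metis m_closed r_right_minus_eq)
  obtain s where "s \<in> carrier R" "c = s \<otimes> f" using c(1) LF by blast
  then have cf: "c \<otimes> f = c" using f by (simp add: m_assoc)
  have c0: "c \<noteq> \<zero>"
  proof
    assume "c = \<zero>"
    then have "b = \<zero>" using c(2) bc by simp
    then show False using b(2) Lc[OF a(1)] by simp
  qed
  \<comment> \<open>From \<open>c\<close> in \<open>R f\<close> only \<open>c f = c\<close> follows;
    multiplying by \<open>f\<close> on the left moves the idempotent into \<open>f R f\<close>. It
    stays nonzero because \<open>c g = c\<close>.\<close>
  define g where "g = f \<otimes> c"
  have gc: "g \<in> carrier R" using f cc by (simp add: g_def)
  have gL: "g \<in> L" using D(4) f c by (simp add: g_def)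
  have gf: "g \<otimes> f = g" "f \<otimes> g = g" using f cc cf by (simp_all add: g_def m_assoc m_assoc[symmetric])
  have "g \<otimes> g = f \<otimes> ((c \<otimes> f) \<otimes> c)" using f cc by (simp add: g_def m_assoc)
  then have gg: "g \<otimes> g = g" by (simp add: cf idem g_def)
  have "c \<otimes> g = (c \<otimes> f) \<otimes> c" using f cc by (simp add: g_def m_assoc)
  then have "c \<otimes> g = c" by (simp add: cf idem)
  then have g0: "g \<noteq> \<zero>" using c0 cc by auto
  have "\<exists>r \<in> carrier R. r \<otimes> (x \<otimes> g) = g" if x: "x \<in> carrier R" "x \<otimes> g \<noteq> \<zero>" for x
  proof -
    have xg: "x \<otimes> g \<in> L" using D(4) gL x by blast
    let ?X = "(\<lambda>r. r \<otimes> (x \<otimes> g)) ` carrier R"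
    have "?X = L"
    proof (rule min')
      show "left_ideal R ?X" using left_ideal_principal x gc by simp
      show "?X \<subseteq> L" using D(4) xg by auto
      show "x \<otimes> g \<in> ?X" using x gc by (intro image_eqI[of _ _ \<one>]) auto
    qed (rule x)
    then have "g \<in> ?X" using gL by simp
    then obtain r where r: "g = r \<otimes> (x \<otimes> g)" "r \<in> carrier R" by (rule imageE)
    show ?thesis using r(1)[symmetric] r(2) by (rule bexI)
  qed
  then have "primitive g" unfolding primitive_def using gc gg g0 by simp
  then show ?thesis using gf by blast
qed

lemma primitiveD:
  assumes "primitive g"
  shows "g \<in> carrier R" "g \<otimes> g = g" "g \<noteq> \<zero>"
    and "\<And>x. x \<in> carrier R \<Longrightarrow> x \<otimes> g \<noteq> \<zero> \<Longrightarrow> \<exists>r \<in> carrier R. r \<otimes> (x \<otimes> g) = g"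
  using assms by (auto simp: primitive_def)

text \<open>If \<open>r g\<close> were nonzero, some \<open>s\<close> would give
  \<open>s r g = g\<close>, hence \<open>d = g d = s r g d = s r d = 0\<close>. So killing one
  nonzero element of \<open>g R\<close> from the left already kills \<open>g\<close>.\<close>

lemma primitive_cancel:
  assumes g: "primitive g" and d: "d \<in> carrier R" "g \<otimes> d = d" "d \<noteq> \<zero>"
    and r: "r \<in> carrier R" "r \<otimes> d = \<zero>"
  shows "r \<otimes> g = \<zero>"
proof (rule ccontr)
  note G = primitiveD[OF g]
  assume "r \<otimes> g \<noteq> \<zero>"
  then obtain s where s: "s \<in> carrier R" "s \<otimes> (r \<otimes> g) = g" using G(4) r(1) by blast
  have "d = (s \<otimes> (r \<otimes> g)) \<otimes> d" using s d by simp
  also have "\<dots> = s \<otimes> (r \<otimes> (g \<otimes> d))" using s(1) d(1) r(1) G(1) by (simp add: m_assoc)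
  also have "\<dots> = \<zero>" using s(1) d r by simp
  finally show False using d(3) by simp
qed

lemma Units_cancel:
  assumes "p \<in> Units R" "r \<in> carrier R" "r \<otimes> p = \<zero>"
  shows "r = \<zero>"
proof -
  have "r = r \<otimes> (p \<otimes> inv p)" using assms(1,2) by simp
  also have "\<dots> = (r \<otimes> p) \<otimes> inv p"
    using assms(1,2) by (intro m_assoc[symmetric]) auto
  finally have "r = (r \<otimes> p) \<otimes> inv p" .
  then show ?thesis using assms by simp
qed

subsection \<open>Writing the identity as a sum of two units\<close>

text \<open>
  In the corner ring \<open>e R e\<close>, both \<open>u\<close> and \<open>e - u\<close> are units. Units of the corner are
  tested in \<open>R\<close> by adding the complementary idempotent \<open>1 - e\<close>.
\<close>

definition unit_pair :: "'a \<Rightarrow> 'a \<Rightarrow> bool" where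
  "unit_pair e u \<longleftrightarrow> e \<in> carrier R \<and> u \<in> carrier R \<and> e \<otimes> e = e \<and> e \<otimes> u = u \<and> u \<otimes> e = u \<and>
     (\<one> \<ominus> e) \<oplus> u \<in> Units R \<and> \<one> \<ominus> u \<in> Units R"

lemma unit_pairD:
  assumes "unit_pair e u"
  shows "e \<in> carrier R" "u \<in> carrier R" "e \<otimes> e = e" "e \<otimes> u = u" "u \<otimes> e = u"
    "(\<one> \<ominus> e) \<oplus> u \<in> Units R" "\<one> \<ominus> u \<in> Units R"
  using assms by (simp_all add: unit_pair_def)

lemma unit_pairI:
  assumes "e \<in> carrier R" "u \<in> carrier R" "e \<otimes> e = e" "e \<otimes> u = u" "u \<otimes> e = u"
    and "\<And>r. r \<in> carrier R \<Longrightarrow> r \<otimes> ((\<one> \<ominus> e) \<oplus> u) = \<zero> \<Longrightarrow> r = \<zero>"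
    and "\<And>r. r \<in> carrier R \<Longrightarrow> r \<otimes> (\<one> \<ominus> u) = \<zero> \<Longrightarrow> r = \<zero>"
  shows "unit_pair e u"
  unfolding unit_pair_def using assms by (auto intro!: Units_if_right_regular)

section \<open>Enlarging a corner by a diagonal block, by matrix units, or by a linked block\<close>

lemma unit_pair_orthogonal:
  assumes G: "unit_pair e u" and x: "x \<in> carrier R"
  shows "e \<otimes> x = \<zero> \<Longrightarrow> u \<otimes> x = \<zero>" "x \<otimes> e = \<zero> \<Longrightarrow> x \<otimes> u = \<zero>"
proof -
  note D = unit_pairD[OF G]
  show "u \<otimes> x = \<zero>" if "e \<otimes> x = \<zero>"
  proof -
    have "u \<otimes> x = u \<otimes> (e \<otimes> x)" using D x by (simp add: m_assoc[symmetric])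
    then show ?thesis using that D by simp
  qed
  show "x \<otimes> u = \<zero>" if "x \<otimes> e = \<zero>"
  proof -
    have "x \<otimes> u = (x \<otimes> e) \<otimes> u" using D x by (simp add: m_assoc)
    then show ?thesis using that D by simp
  qed
qed

text \<open>The new element is block diagonal with blocks \<open>u\<close> and \<open>d\<close>. As
  \<open>g\<close> is primitive, the nonzero elements \<open>d\<close> and \<open>g - d\<close> of
  \<open>g R g\<close> can be cancelled, so both block sums behave like units.\<close>

lemma unit_pair_add_division:
  assumes G: "unit_pair e u" and P: "primitive g" and o: "e \<otimes> g = \<zero>" "g \<otimes> e = \<zero>"
    and d: "d \<in> carrier R" "g \<otimes> d = d" "d \<otimes> g = d" "d \<noteq> \<zero>" "d \<noteq> g"
  shows "unit_pair (e \<oplus> g) (u \<oplus> d)"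
proof -
  note D = unit_pairD[OF G] and g = primitiveD(1-3)[OF P]
  have ed: "e \<otimes> d = \<zero>"
  proof -
    have "e \<otimes> d = (e \<otimes> g) \<otimes> d" using D(1) g(1) d by (simp add: m_assoc)
    then show ?thesis using o d by simp
  qed
  have de: "d \<otimes> e = \<zero>"
  proof -
    have "d \<otimes> e = d \<otimes> (g \<otimes> e)" using D(1) g(1) d by (simp add: m_assoc[symmetric])
    then show ?thesis using o d by simp
  qed
  have ug: "u \<otimes> g = \<zero>" "g \<otimes> u = \<zero>" using unit_pair_orthogonal[OF G g(1)] o by simp_all
  show ?thesis
  proof (rule unit_pairI)
    show "(e \<oplus> g) \<otimes> (e \<oplus> g) = e \<oplus> g" "(e \<oplus> g) \<otimes> (u \<oplus> d) = u \<oplus> d" "(u \<oplus> d) \<otimes> (e \<oplus> g) = u \<oplus> d"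
      using D(1-5) g d o ed de ug by (simp_all add: l_distr r_distr)
    fix r assume r: "r \<in> carrier R"
    show "r = \<zero>" if z: "r \<otimes> ((\<one> \<ominus> (e \<oplus> g)) \<oplus> (u \<oplus> d)) = \<zero>"
    proof -
      \<comment> \<open>Right multiplication by \<open>g\<close> isolates the block
        \<open>d\<close>. The vanishing products are written out so that the next equality is a
        formal ring identity, free of the orthogonality relations; the later block computations
        follow the same pattern.\<close>
      have "r \<otimes> d = r \<otimes> (g \<ominus> (e \<otimes> g \<oplus> g \<otimes> g) \<oplus> (u \<otimes> g \<oplus> d \<otimes> g))"
        using g d o ug by (simp add: minus_eq r_neg)
      also have "\<dots> = (r \<otimes> ((\<one> \<ominus> (e \<oplus> g)) \<oplus> (u \<oplus> d))) \<otimes> g"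
        using D(1,2) g(1) d(1) r by algebra
      finally have rd: "r \<otimes> d = \<zero>" using z g by simp
      then have rg: "r \<otimes> g = \<zero>" using primitive_cancel[OF P d(1,2,4) r] by simp
      \<comment> \<open>Once \<open>r\<close> kills \<open>g\<close> and \<open>d\<close>, the new
        element may be replaced by the old unit, which can be cancelled.\<close>
      have "r \<otimes> ((\<one> \<ominus> e) \<oplus> u) = r \<otimes> ((\<one> \<ominus> (e \<oplus> g)) \<oplus> (u \<oplus> d)) \<oplus> (r \<otimes> g \<ominus> r \<otimes> d)"
        using D(1,2) g(1) d(1) r by algebra
      then have "r \<otimes> ((\<one> \<ominus> e) \<oplus> u) = \<zero>" using z rd rg by (simp add: minus_eq)
      then show ?thesis using Units_cancel D r by blast
    qed
    show "r = \<zero>" if z: "r \<otimes> (\<one> \<ominus> (u \<oplus> d)) = \<zero>"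
    proof -
      have "r \<otimes> (g \<ominus> d) = r \<otimes> (g \<ominus> (u \<otimes> g \<oplus> d \<otimes> g))"
        using g d ug by simp
      also have "\<dots> = (r \<otimes> (\<one> \<ominus> (u \<oplus> d))) \<otimes> g"
        using D(1,2) g(1) d(1) r by algebra
      finally have rgd: "r \<otimes> (g \<ominus> d) = \<zero>" using z g by simp
      have gd: "g \<ominus> d \<noteq> \<zero>" using d(1,5) g(1) by (metis r_right_minus_eq)
      have "g \<otimes> (g \<ominus> d) = g \<otimes> g \<ominus> g \<otimes> d" using d(1) g(1) by algebra
      then have "g \<otimes> (g \<ominus> d) = g \<ominus> d" using g d by simp
      then have rg: "r \<otimes> g = \<zero>" using primitive_cancel[OF P _ _ gd r rgd] d g by simp
      have "r \<otimes> (\<one> \<ominus> u) = r \<otimes> (\<one> \<ominus> (u \<oplus> d)) \<oplus> (r \<otimes> g \<ominus> r \<otimes> (g \<ominus> d))"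
        using D(2) g(1) d(1) r by algebra
      then have "r \<otimes> (\<one> \<ominus> u) = \<zero>" using z rgd rg by (simp add: minus_eq)
      then show ?thesis using Units_cancel D r by blast
    qed
  qed (use D g d in auto)
qed

text \<open>
  Here \<open>g, a, b, b a\<close> are matrix units of a copy of the \<open>2 \<times> 2\<close> matrices, and
  \<open>w = a + b + b a\<close> satisfies \<open>w (w - 1) = 1\<close>, so that \<open>w\<close> and \<open>1 - w\<close> are units.
\<close>

lemma unit_pair_add_matrix_units:
  assumes G: "unit_pair e u" and g: "g \<in> carrier R" and o: "e \<otimes> g = \<zero>" "g \<otimes> e = \<zero>"
    and ab: "a \<in> carrier R" "b \<in> carrier R" "a \<otimes> b = g" "g \<otimes> a = a" "b \<otimes> g = b"
    and z: "a \<otimes> g = \<zero>" "g \<otimes> b = \<zero>" "a \<otimes> e = \<zero>" "e \<otimes> b = \<zero>"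
  shows "unit_pair (e \<oplus> (g \<oplus> b \<otimes> a)) (u \<oplus> (a \<oplus> (b \<oplus> b \<otimes> a)))"
proof -
  note D = unit_pairD[OF G]
  define h where "h = b \<otimes> a"
  have h: "h \<in> carrier R" using ab by (simp add: h_def)
  note cl = D(1,2) g ab(1,2) h
  have m: "e \<otimes> h = \<zero>" "h \<otimes> e = \<zero>" "g \<otimes> h = \<zero>" "h \<otimes> g = \<zero>"
  proof -
    have "e \<otimes> h = (e \<otimes> b) \<otimes> a" "h \<otimes> e = b \<otimes> (a \<otimes> e)"
      "g \<otimes> h = (g \<otimes> b) \<otimes> a" "h \<otimes> g = b \<otimes> (a \<otimes> g)"
      using cl by (simp_all add: h_def m_assoc)
    then show "e \<otimes> h = \<zero>" "h \<otimes> e = \<zero>" "g \<otimes> h = \<zero>" "h \<otimes> g = \<zero>" using z cl by simp_all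
  qed
  have m2: "e \<otimes> a = \<zero>" "b \<otimes> e = \<zero>" "b \<otimes> h = \<zero>" "h \<otimes> a = \<zero>" "a \<otimes> a = \<zero>" "b \<otimes> b = \<zero>"
    "a \<otimes> h = a" "h \<otimes> b = b" "h \<otimes> h = h" "g \<otimes> g = g"
  proof -
    have "e \<otimes> a = (e \<otimes> g) \<otimes> a" using cl ab by (simp add: m_assoc)
    then show "e \<otimes> a = \<zero>" using o cl by simp
    have "b \<otimes> e = b \<otimes> (g \<otimes> e)" using cl ab by (simp add: m_assoc[symmetric])
    then show "b \<otimes> e = \<zero>" using o cl by simp
    have "b \<otimes> h = b \<otimes> (g \<otimes> h)" using cl ab by (simp add: m_assoc[symmetric])
    then show "b \<otimes> h = \<zero>" using m cl by simp
    have "h \<otimes> a = (h \<otimes> g) \<otimes> a" using cl ab by (simp add: m_assoc)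
    then show "h \<otimes> a = \<zero>" using m cl by simp
    have "a \<otimes> a = (a \<otimes> g) \<otimes> a" using cl ab by (simp add: m_assoc)
    then show "a \<otimes> a = \<zero>" using z cl by simp
    have "b \<otimes> b = b \<otimes> (g \<otimes> b)" using cl ab by (simp add: m_assoc[symmetric])
    then show "b \<otimes> b = \<zero>" using z cl by simp
    have "a \<otimes> h = (a \<otimes> b) \<otimes> a" using cl by (simp add: h_def m_assoc)
    then show ah: "a \<otimes> h = a" using ab by simp
    have "h \<otimes> b = b \<otimes> (a \<otimes> b)" using cl by (simp add: h_def m_assoc)
    then show "h \<otimes> b = b" using ab by simp
    have "h \<otimes> h = b \<otimes> (a \<otimes> h)" using cl by (simp add: h_def m_assoc)
    then show "h \<otimes> h = h" unfolding ah by (simp add: h_def)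
    have "g \<otimes> g = (g \<otimes> a) \<otimes> b" using cl ab(3) by (simp add: m_assoc)
    then show "g \<otimes> g = g" using ab by simp
  qed
  have mu: "u \<otimes> g = \<zero>" "g \<otimes> u = \<zero>" "u \<otimes> h = \<zero>" "h \<otimes> u = \<zero>" "u \<otimes> a = \<zero>" "a \<otimes> u = \<zero>"
    "u \<otimes> b = \<zero>" "b \<otimes> u = \<zero>"
    using unit_pair_orthogonal[OF G] cl o m m2 z by simp_all
  have goal: "unit_pair (e \<oplus> (g \<oplus> h)) (u \<oplus> (a \<oplus> (b \<oplus> h)))"
  proof (rule unit_pairI)
    show "(e \<oplus> (g \<oplus> h)) \<otimes> (e \<oplus> (g \<oplus> h)) = e \<oplus> (g \<oplus> h)"
      "(e \<oplus> (g \<oplus> h)) \<otimes> (u \<oplus> (a \<oplus> (b \<oplus> h))) = u \<oplus> (a \<oplus> (b \<oplus> h))"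
      "(u \<oplus> (a \<oplus> (b \<oplus> h))) \<otimes> (e \<oplus> (g \<oplus> h)) = u \<oplus> (a \<oplus> (b \<oplus> h))"
      using cl D(3-5) ab z o m m2 mu by (simp_all add: l_distr r_distr a_ac)
    fix r assume r: "r \<in> carrier R"
    show "r = \<zero>" if W: "r \<otimes> ((\<one> \<ominus> (e \<oplus> (g \<oplus> h))) \<oplus> (u \<oplus> (a \<oplus> (b \<oplus> h)))) = \<zero>"
    proof -
      let ?W = "(\<one> \<ominus> (e \<oplus> (g \<oplus> h))) \<oplus> (u \<oplus> (a \<oplus> (b \<oplus> h)))"
      \<comment> \<open>With \<open>w = a + b + h\<close>, the columns are \<open>w g = b\<close>
        and \<open>w h = a + h\<close>. The first gives \<open>r b = 0\<close> and thus
        \<open>r h = r b a = 0\<close>; the second then gives \<open>r a = 0\<close> and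
        \<open>r g = r a b = 0\<close>.\<close>
      have "r \<otimes> b = r \<otimes> (g \<ominus> (e \<otimes> g \<oplus> (g \<otimes> g \<oplus> h \<otimes> g)) \<oplus> (u \<otimes> g \<oplus> (a \<otimes> g \<oplus> (b \<otimes> g \<oplus> h \<otimes> g))))"
        using cl ab z o m m2 mu by (simp add: minus_eq r_neg)
      also have "\<dots> = (r \<otimes> ?W) \<otimes> g"
        using cl r by algebra
      finally have rb: "r \<otimes> b = \<zero>" using W cl by simp
      have "r \<otimes> h = (r \<otimes> b) \<otimes> a" using cl r by (simp add: h_def m_assoc)
      then have rh: "r \<otimes> h = \<zero>" using rb cl by simp
      have "r \<otimes> (a \<oplus> h) = r \<otimes> (h \<ominus> (e \<otimes> h \<oplus> (g \<otimes> h \<oplus> h \<otimes> h)) \<oplus> (u \<otimes> h \<oplus> (a \<otimes> h \<oplus> (b \<otimes> h \<oplus> h \<otimes> h))))"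
        using cl ab z o m m2 mu by (simp add: minus_eq r_neg)
      also have "\<dots> = (r \<otimes> ?W) \<otimes> h"
        using cl r by algebra
      finally have "r \<otimes> a = \<zero>" using W cl r rh by (simp add: r_distr)
      moreover have "r \<otimes> g = (r \<otimes> a) \<otimes> b" using cl r by (simp add: m_assoc ab)
      ultimately have ra: "r \<otimes> a = \<zero>" "r \<otimes> g = \<zero>" using cl by simp_all
      have "r \<otimes> ((\<one> \<ominus> e) \<oplus> u) = r \<otimes> ?W \<oplus> (r \<otimes> g \<ominus> (r \<otimes> a \<oplus> r \<otimes> b))"
        using cl r by algebra
      then have "r \<otimes> ((\<one> \<ominus> e) \<oplus> u) = \<zero>" using W ra rb by (simp add: minus_eq)
      then show ?thesis using Units_cancel D r by blast
    qed
    show "r = \<zero>" if W: "r \<otimes> (\<one> \<ominus> (u \<oplus> (a \<oplus> (b \<oplus> h)))) = \<zero>"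
    proof -
      let ?W = "\<one> \<ominus> (u \<oplus> (a \<oplus> (b \<oplus> h)))"
      \<comment> \<open>For \<open>g + h - w\<close> the columns are \<open>- a\<close> under
        \<open>h\<close> and \<open>g - b\<close> under \<open>g\<close>, so here \<open>r a\<close>
        vanishes first, then \<open>r g\<close>, \<open>r b\<close> and \<open>r h\<close>.\<close>
      have "\<ominus> (r \<otimes> a) = r \<otimes> (h \<ominus> (a \<oplus> h))"
        using cl r by algebra
      also have "\<dots> = r \<otimes> (h \<ominus> (u \<otimes> h \<oplus> (a \<otimes> h \<oplus> (b \<otimes> h \<oplus> h \<otimes> h))))"
        using cl m2 mu by simp
      also have "\<dots> = (r \<otimes> ?W) \<otimes> h"
        using cl r by algebra
      finally have "\<ominus> (r \<otimes> a) = \<zero>" using W cl by simp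
      then have ra: "r \<otimes> a = \<zero>" using cl r by (metis m_closed minus_minus minus_zero)
      have "r \<otimes> g = (r \<otimes> a) \<otimes> b" using cl r by (simp add: m_assoc ab)
      then have rg: "r \<otimes> g = \<zero>" using ra cl by simp
      have "r \<otimes> g \<ominus> r \<otimes> b = r \<otimes> (g \<ominus> b)" using cl r by algebra
      also have "\<dots> = r \<otimes> (g \<ominus> (u \<otimes> g \<oplus> (a \<otimes> g \<oplus> (b \<otimes> g \<oplus> h \<otimes> g))))"
        using cl ab z o m m2 mu by simp
      also have "\<dots> = (r \<otimes> ?W) \<otimes> g"
        using cl r by algebra
      finally have "r \<otimes> g \<ominus> r \<otimes> b = \<zero>" using W cl by simp
      then have rb: "r \<otimes> b = \<zero>" using rg cl r by (metis m_closed r_right_minus_eq)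
      have "r \<otimes> h = (r \<otimes> b) \<otimes> a" using cl r by (simp add: h_def m_assoc)
      then have rh: "r \<otimes> h = \<zero>" using rb cl by simp
      have "r \<otimes> (\<one> \<ominus> u) = r \<otimes> ?W \<oplus> (r \<otimes> a \<oplus> (r \<otimes> b \<oplus> r \<otimes> h))"
        using cl r by algebra
      then have "r \<otimes> (\<one> \<ominus> u) = \<zero>" using W ra rb rh by simp
      then show ?thesis using Units_cancel D r by blast
    qed
  qed (use cl in auto)
  then show ?thesis by (simp add: h_def)
qed

text \<open>Both units commute with \<open>e\<close>, hence so do their inverses. Cutting down by
  \<open>e\<close> turns the units into \<open>u\<close> and \<open>e - u\<close>, so their inverses
  in \<open>R\<close> act as inverses in the corner.\<close>

lemma unit_pair_inv_mult:
  assumes G: "unit_pair e u"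
  shows "u \<otimes> inv ((\<one> \<ominus> e) \<oplus> u) = e" "(e \<ominus> u) \<otimes> inv (\<one> \<ominus> u) = e"
    "e \<otimes> inv ((\<one> \<ominus> e) \<oplus> u) = inv ((\<one> \<ominus> e) \<oplus> u) \<otimes> e"
    "e \<otimes> inv (\<one> \<ominus> u) = inv (\<one> \<ominus> u) \<otimes> e"
proof -
  note D = unit_pairD[OF G]
  have key: "e \<otimes> w \<otimes> inv w = e" "w \<otimes> e = e \<otimes> w \<Longrightarrow> e \<otimes> inv w = inv w \<otimes> e" if w: "w \<in> Units R" for w
  proof -
    have wc: "w \<in> carrier R" "inv w \<in> carrier R" using w by auto
    show "e \<otimes> w \<otimes> inv w = e" using D(1) w wc by (simp add: m_assoc)
    assume c: "w \<otimes> e = e \<otimes> w"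
    have "e \<otimes> inv w = (inv w \<otimes> w) \<otimes> (e \<otimes> inv w)" using D(1) w wc by simp
    also have "\<dots> = inv w \<otimes> ((w \<otimes> e) \<otimes> inv w)" using D(1) wc by (simp add: m_assoc)
    also have "\<dots> = inv w \<otimes> (e \<otimes> w \<otimes> inv w)" unfolding c ..
    also have "\<dots> = inv w \<otimes> e" using \<open>e \<otimes> w \<otimes> inv w = e\<close> by simp
    finally show "e \<otimes> inv w = inv w \<otimes> e" .
  qed
  have P: "e \<otimes> ((\<one> \<ominus> e) \<oplus> u) = u" "((\<one> \<ominus> e) \<oplus> u) \<otimes> e = u"
    and Q: "e \<otimes> (\<one> \<ominus> u) = e \<ominus> u" "(\<one> \<ominus> u) \<otimes> e = e \<ominus> u"
    using D(1-5) by (simp_all add: minus_eq l_distr r_distr l_minus r_minus r_neg)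
  show "u \<otimes> inv ((\<one> \<ominus> e) \<oplus> u) = e" "e \<otimes> inv ((\<one> \<ominus> e) \<oplus> u) = inv ((\<one> \<ominus> e) \<oplus> u) \<otimes> e"
    using key[OF D(6)] P by simp_all
  show "(e \<ominus> u) \<otimes> inv (\<one> \<ominus> u) = e" "e \<otimes> inv (\<one> \<ominus> u) = inv (\<one> \<ominus> u) \<otimes> e"
    using key[OF D(7)] Q by simp_all
qed

text \<open>
  In block form with respect to \<open>e\<close> and \<open>g\<close>, the new element has rows \<open>(u, x)\<close> and \<open>(y, 0)\<close>.
  The last two hypotheses make the Schur complements of it and of its complement \<open>- g\<close> and \<open>g\<close>.
\<close>

lemma unit_pair_add_linked:
  assumes G: "unit_pair e u" and g: "g \<in> carrier R" "g \<otimes> g = g" and o: "e \<otimes> g = \<zero>" "g \<otimes> e = \<zero>"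
    and x: "x \<in> carrier R" "e \<otimes> x = x" "x \<otimes> g = x"
    and y: "y \<in> carrier R" "g \<otimes> y = y" "y \<otimes> e = y"
    and yVx: "y \<otimes> inv ((\<one> \<ominus> e) \<oplus> u) \<otimes> x = g" and yTx: "y \<otimes> inv (\<one> \<ominus> u) \<otimes> x = \<zero>"
  shows "unit_pair (e \<oplus> g) (u \<oplus> (x \<oplus> y))"
proof -
  note D = unit_pairD[OF G]
  let ?V = "inv ((\<one> \<ominus> e) \<oplus> u)" and ?T = "inv (\<one> \<ominus> u)"
  have V: "?V \<in> carrier R" and T: "?T \<in> carrier R" using D by simp_all
  note uV = unit_pair_inv_mult(1)[OF G] and uT = unit_pair_inv_mult(2)[OF G]
  note cl = D(1,2) g(1) x(1) y(1)
  have m: "g \<otimes> x = \<zero>" "x \<otimes> e = \<zero>" "e \<otimes> y = \<zero>" "y \<otimes> g = \<zero>"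
  proof -
    have "g \<otimes> x = (g \<otimes> e) \<otimes> x" "e \<otimes> y = (e \<otimes> g) \<otimes> y" using cl x y by (simp_all add: m_assoc)
    then show "g \<otimes> x = \<zero>" "e \<otimes> y = \<zero>" using o cl by simp_all
    have "x \<otimes> e = x \<otimes> (g \<otimes> e)" "y \<otimes> g = y \<otimes> (e \<otimes> g)" using cl x y by (simp_all add: m_assoc[symmetric])
    then show "x \<otimes> e = \<zero>" "y \<otimes> g = \<zero>" using o cl by simp_all
  qed
  have mu: "u \<otimes> g = \<zero>" "g \<otimes> u = \<zero>" using unit_pair_orthogonal[OF G] cl o by simp_all
  show ?thesis
  proof (rule unit_pairI)
    show "(e \<oplus> g) \<otimes> (e \<oplus> g) = e \<oplus> g" "(e \<oplus> g) \<otimes> (u \<oplus> (x \<oplus> y)) = u \<oplus> (x \<oplus> y)"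
      "(u \<oplus> (x \<oplus> y)) \<otimes> (e \<oplus> g) = u \<oplus> (x \<oplus> y)"
      using cl D(3-5) g x y o m mu by (simp_all add: l_distr r_distr a_ac)
    fix r assume r: "r \<in> carrier R"
    show "r = \<zero>" if W: "r \<otimes> ((\<one> \<ominus> (e \<oplus> g)) \<oplus> (u \<oplus> (x \<oplus> y))) = \<zero>"
    proof -
      let ?W = "(\<one> \<ominus> (e \<oplus> g)) \<oplus> (u \<oplus> (x \<oplus> y))"
      have "r \<otimes> x = r \<otimes> (g \<ominus> (e \<otimes> g \<oplus> g \<otimes> g) \<oplus> (u \<otimes> g \<oplus> (x \<otimes> g \<oplus> y \<otimes> g)))"
        using cl g x o m mu by (simp add: minus_eq r_neg)
      also have "\<dots> = (r \<otimes> ?W) \<otimes> g" using cl r by algebra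
      finally have rx: "r \<otimes> x = \<zero>" using W cl by simp
      have "r \<otimes> (u \<oplus> y) = r \<otimes> (e \<ominus> (e \<otimes> e \<oplus> g \<otimes> e) \<oplus> (u \<otimes> e \<oplus> (x \<otimes> e \<oplus> y \<otimes> e)))"
        using cl D(3-5) y o m by (simp add: minus_eq r_neg)
      also have "\<dots> = (r \<otimes> ?W) \<otimes> e" using cl r by algebra
      finally have ruy: "r \<otimes> (u \<oplus> y) = \<zero>" using W cl by simp
      \<comment> \<open>Column elimination: right multiplication by \<open>?V x\<close> turns
        \<open>u\<close> into \<open>x\<close> and \<open>y\<close> into \<open>g\<close>. So
        \<open>r (u + y) = 0\<close> gives \<open>r x + r g = 0\<close>, where \<open>r x\<close> is
        already zero.\<close>
      have "r \<otimes> g = r \<otimes> x \<oplus> r \<otimes> g" using rx cl r by simp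
      also have "\<dots> = r \<otimes> ((u \<otimes> ?V) \<otimes> x) \<oplus> r \<otimes> (y \<otimes> ?V \<otimes> x)" unfolding uV yVx using x by simp
      also have "\<dots> = (r \<otimes> (u \<oplus> y)) \<otimes> (?V \<otimes> x)" using cl r V by (simp add: l_distr r_distr m_assoc)
      also have "\<dots> = \<zero>" unfolding ruy using V cl by simp
      finally have rg: "r \<otimes> g = \<zero>" .
      have "r \<otimes> y = (r \<otimes> g) \<otimes> y" using cl r y by (simp add: m_assoc)
      then have ry: "r \<otimes> y = \<zero>" using rg cl by simp
      have "r \<otimes> ((\<one> \<ominus> e) \<oplus> u) = r \<otimes> ?W \<oplus> (r \<otimes> g \<ominus> (r \<otimes> x \<oplus> r \<otimes> y))"
        using cl r by algebra
      then have "r \<otimes> ((\<one> \<ominus> e) \<oplus> u) = \<zero>" using W rx ry rg by (simp add: minus_eq)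
      then show ?thesis using Units_cancel D r by blast
    qed
    show "r = \<zero>" if W: "r \<otimes> (\<one> \<ominus> (u \<oplus> (x \<oplus> y))) = \<zero>"
    proof -
      let ?W = "\<one> \<ominus> (u \<oplus> (x \<oplus> y))"
      have "r \<otimes> g \<ominus> r \<otimes> x = r \<otimes> (g \<ominus> x)" using cl r by algebra
      also have "\<dots> = r \<otimes> (g \<ominus> (u \<otimes> g \<oplus> (x \<otimes> g \<oplus> y \<otimes> g)))" using cl x m mu by simp
      also have "\<dots> = (r \<otimes> ?W) \<otimes> g" using cl r by algebra
      finally have "r \<otimes> g \<ominus> r \<otimes> x = \<zero>" using W cl by simp
      then have rgx: "r \<otimes> g = r \<otimes> x" using cl r by simp
      have "r \<otimes> ((e \<ominus> u) \<ominus> y) = r \<otimes> (e \<ominus> (u \<oplus> y))" using cl r by algebra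
      also have "\<dots> = r \<otimes> (e \<ominus> (u \<otimes> e \<oplus> (x \<otimes> e \<oplus> y \<otimes> e)))" using cl D(3-5) y m by simp
      also have "\<dots> = (r \<otimes> ?W) \<otimes> e" using cl r by algebra
      finally have reuy: "r \<otimes> ((e \<ominus> u) \<ominus> y) = \<zero>" using W cl by simp
      \<comment> \<open>The same elimination with \<open>?T x\<close>: it turns \<open>e - u\<close>
        into \<open>x\<close> and \<open>y\<close> into \<open>0\<close>, so \<open>r x = 0\<close>,
        and \<open>r g = r x\<close> finishes this block.\<close>
      have "r \<otimes> x = r \<otimes> (((e \<ominus> u) \<otimes> ?T) \<otimes> x) \<ominus> r \<otimes> (y \<otimes> ?T \<otimes> x)"
        unfolding uT yTx using x r cl by (simp add: minus_eq)
      also have "\<dots> = (r \<otimes> ((e \<ominus> u) \<ominus> y)) \<otimes> (?T \<otimes> x)"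
        using cl r T by (simp add: minus_eq l_distr r_distr m_assoc l_minus r_minus)
      also have "\<dots> = \<zero>" unfolding reuy using T cl by simp
      finally have rx: "r \<otimes> x = \<zero>" .
      then have rg: "r \<otimes> g = \<zero>" using rgx by simp
      have "r \<otimes> y = (r \<otimes> g) \<otimes> y" using cl r y by (simp add: m_assoc)
      then have ry: "r \<otimes> y = \<zero>" using rg cl by simp
      have "r \<otimes> (\<one> \<ominus> u) = r \<otimes> ?W \<oplus> (r \<otimes> x \<oplus> r \<otimes> y)"
        using cl r by algebra
      then have "r \<otimes> (\<one> \<ominus> u) = \<zero>" using W rx ry by simp
      then show ?thesis using Units_cancel D r by blast
    qed
  qed (use cl in auto)
qed

text \<open>The ideal generated by \<open>g\<close> is \<open>{0, g}\<close>, a copy of \<open>\<int>\<^sub>2\<close> splitting off \<open>R\<close>.\<close>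

definition binary_central :: "'a \<Rightarrow> bool" where
  "binary_central g \<longleftrightarrow> g \<in> carrier R \<and> g \<otimes> g = g \<and> g \<noteq> \<zero> \<and>
     (\<forall>r \<in> carrier R. g \<otimes> r = r \<otimes> g \<and> (g \<otimes> r = \<zero> \<or> g \<otimes> r = g))"

text \<open>The condition on the right says \<open>g R (1 - g) = 0\<close>; semiprimeness transfers
  it to \<open>(1 - g) R g = 0\<close>. Indeed \<open>c = r g - g r g\<close> satisfies
  \<open>c = c g\<close> and \<open>g s c = 0\<close> for every \<open>s\<close>, so
  \<open>c s c = 0\<close>.\<close>

lemma binary_centralI:
  assumes g: "g \<in> carrier R" "g \<otimes> g = g" "g \<noteq> \<zero>"
    and bin: "\<And>r. r \<in> carrier R \<Longrightarrow> g \<otimes> r \<otimes> g = \<zero> \<or> g \<otimes> r \<otimes> g = g"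
    and right: "\<And>r. r \<in> carrier R \<Longrightarrow> g \<otimes> r \<otimes> g = g \<otimes> r"
  shows "binary_central g"
proof -
  have left: "r \<otimes> g = g \<otimes> r \<otimes> g" if r: "r \<in> carrier R" for r
  proof -
    let ?c = "r \<otimes> g \<ominus> g \<otimes> r \<otimes> g"
    have c: "?c \<in> carrier R" using r g by simp
    have "?c = \<zero>"
    proof (rule semiprime[OF c])
      fix s assume s: "s \<in> carrier R"
      have cg: "?c = ?c \<otimes> g" using r g by (simp add: minus_eq l_distr l_minus m_assoc)
      have "g \<otimes> s \<otimes> ?c = g \<otimes> (s \<otimes> r) \<otimes> g \<ominus> (g \<otimes> s \<otimes> g) \<otimes> (r \<otimes> g)"
        using r s g(1) by algebra
      also have "\<dots> = g \<otimes> (s \<otimes> r) \<otimes> g \<ominus> (g \<otimes> s) \<otimes> (r \<otimes> g)"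
        using right s by simp
      also have "\<dots> = \<zero>" using r s g(1) by (simp add: m_assoc minus_eq r_neg)
      finally have "?c \<otimes> (g \<otimes> s \<otimes> ?c) = \<zero>" using c by simp
      moreover have "(?c \<otimes> g) \<otimes> s \<otimes> ?c = ?c \<otimes> (g \<otimes> s \<otimes> ?c)"
        using c g(1) s by (simp only: m_assoc m_closed)
      ultimately show "?c \<otimes> s \<otimes> ?c = \<zero>" by (simp flip: cg)
    qed
    then show ?thesis using r g by simp
  qed
  have "g \<otimes> r = r \<otimes> g" "g \<otimes> r = \<zero> \<or> g \<otimes> r = g" if r: "r \<in> carrier R" for r
    using left[OF r] right[OF r] bin[OF r] by simp_all
  then show ?thesis unfolding binary_central_def using g by blast
qed

text \<open>
  Multiplication identifies \<open>g R e\<close> with functionals on \<open>e R g\<close> over the field \<open>{0, g}\<close>; those given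
  by \<open>y V\<close> and \<open>y T\<close>, with \<open>V\<close>, \<open>T\<close> the two inverses, are nonzero, and distinct because \<open>2 g = 0\<close>.
\<close>

lemma ex_linking_elements:
  assumes G: "unit_pair e u" and g: "g \<in> carrier R" "g \<otimes> g = g" "g \<noteq> \<zero>"
    and bin: "\<And>r. r \<in> carrier R \<Longrightarrow> g \<otimes> r \<otimes> g = \<zero> \<or> g \<otimes> r \<otimes> g = g"
    and y: "y \<in> carrier R" "g \<otimes> y = y" "y \<otimes> e = y" "y \<noteq> \<zero>"
  shows "\<exists>x \<in> carrier R. e \<otimes> x = x \<and> x \<otimes> g = x \<and>
     y \<otimes> inv ((\<one> \<ominus> e) \<oplus> u) \<otimes> x = g \<and> y \<otimes> inv (\<one> \<ominus> u) \<otimes> x = \<zero>"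
proof -
  note D = unit_pairD[OF G]
  let ?P = "(\<one> \<ominus> e) \<oplus> u" and ?Q = "\<one> \<ominus> u"
  define y1 where "y1 = y \<otimes> inv ?P"
  define y2 where "y2 = y \<otimes> inv ?Q"
  have Vc: "inv ?P \<in> carrier R" "inv ?Q \<in> carrier R" using D by simp_all
  have yc: "y1 \<in> carrier R" "y2 \<in> carrier R" using y Vc by (simp_all add: y1_def y2_def)
  have y1: "g \<otimes> y1 = y1" "y1 \<otimes> e = y1"
  proof -
    show "g \<otimes> y1 = y1" unfolding y1_def using g(1) y Vc by (simp add: m_assoc[symmetric])
    have "y1 \<otimes> e = y \<otimes> (e \<otimes> inv ?P)"
      unfolding y1_def unit_pair_inv_mult(3)[OF G] using D(1) y(1) Vc by (simp only: m_assoc m_closed)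
    also have "\<dots> = (y \<otimes> e) \<otimes> inv ?P" using D(1) y(1) Vc by (simp only: m_assoc m_closed)
    finally show "y1 \<otimes> e = y1" by (simp add: y y1_def)
  qed
  have y2: "g \<otimes> y2 = y2" "y2 \<otimes> e = y2"
  proof -
    show "g \<otimes> y2 = y2" unfolding y2_def using g(1) y Vc by (simp add: m_assoc[symmetric])
    have "y2 \<otimes> e = y \<otimes> (e \<otimes> inv ?Q)"
      unfolding y2_def unit_pair_inv_mult(4)[OF G] using D(1) y(1) Vc by (simp only: m_assoc m_closed)
    also have "\<dots> = (y \<otimes> e) \<otimes> inv ?Q" using D(1) y(1) Vc by (simp only: m_assoc m_closed)
    finally show "y2 \<otimes> e = y2" by (simp add: y y2_def)
  qed
  have gg: "g \<oplus> g = \<zero>"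
  proof -
    have "g \<otimes> (\<one> \<oplus> \<one>) \<otimes> g = g \<oplus> g" using g by (simp add: l_distr r_distr)
    then have "g \<oplus> g = \<zero> \<or> g \<oplus> g = g" using bin[of "\<one> \<oplus> \<one>"] by simp
    then show ?thesis using g(1,3) add.r_cancel_one[of g g] by auto
  qed
  have y1P: "y1 \<otimes> ?P = y" and y2Q: "y2 \<otimes> ?Q = y"
    using D y(1) Vc by (simp_all add: y1_def y2_def m_assoc del: Units_l_inv) (simp_all add: D y)
  have y10: "y1 \<noteq> \<zero>"
  proof
    assume "y1 = \<zero>"
    then have "y = \<zero>" using y1P D by simp
    then show False using y(4) by simp
  qed
  have y12: "y1 \<ominus> y2 \<noteq> \<zero>"
  proof
    assume "y1 \<ominus> y2 = \<zero>"
    then have eq: "y1 = y2" using yc by simp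
    \<comment> \<open>If \<open>y1 = y2\<close>, multiplying by the commuting factors
      \<open>?P\<close> and \<open>?Q\<close> gives \<open>y ?Q = y ?P\<close>, that is,
      \<open>y - y u = y u\<close>. Then \<open>y = y u + y u = (g + g) y u = 0\<close>.\<close>
    have "y \<otimes> ?Q = y1 \<otimes> ?P \<otimes> ?Q" unfolding y1P ..
    also have "\<dots> = y1 \<otimes> ?Q \<otimes> ?P"
    proof -
      have Q: "c \<otimes> ?Q = c \<ominus> c \<otimes> u" "?Q \<otimes> c = c \<ominus> u \<otimes> c" if "c \<in> carrier R" for c
        using D(2) that by (simp_all add: minus_eq l_distr r_distr l_minus r_minus)
      have "(\<one> \<ominus> e) \<otimes> u = \<zero>" "u \<otimes> (\<one> \<ominus> e) = \<zero>"
        using D(1,2,4,5) by (simp_all add: minus_eq l_distr r_distr l_minus r_minus r_neg)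
      then have "(\<one> \<ominus> e) \<otimes> ?Q = \<one> \<ominus> e" "?Q \<otimes> (\<one> \<ominus> e) = \<one> \<ominus> e" "u \<otimes> ?Q = ?Q \<otimes> u"
        using D(1,2) Q[of "\<one> \<ominus> e"] Q[of u] by (simp_all add: minus_eq)
      then have "?P \<otimes> ?Q = ?Q \<otimes> ?P" using D(1,2) by (simp add: l_distr r_distr)
      then show ?thesis using yc D(1,2) by (simp add: m_assoc)
    qed
    also have "\<dots> = y \<otimes> ?P" unfolding eq y2Q ..
    finally have "y \<ominus> y \<otimes> u = (y \<ominus> y \<otimes> e) \<oplus> y \<otimes> u"
      using y(1) D(1,2) by (simp add: minus_eq r_distr r_minus)
    then have "y \<ominus> y \<otimes> u = y \<otimes> u" using y D(1,2) by (simp add: minus_eq r_neg)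
    then have "(y \<ominus> y \<otimes> u) \<oplus> y \<otimes> u = y \<otimes> u \<oplus> y \<otimes> u" by simp
    also have "\<dots> = g \<otimes> y \<otimes> u \<oplus> g \<otimes> y \<otimes> u" using y by simp
    also have "\<dots> = (g \<oplus> g) \<otimes> (y \<otimes> u)" using g(1) y(1) D(2) by (simp add: l_distr m_assoc)
    finally have "(y \<ominus> y \<otimes> u) \<oplus> y \<otimes> u = \<zero>" using gg y(1) D(2) by simp
    then have "y = \<zero>" using y(1) D(2) by (simp add: minus_eq a_assoc l_neg)
    then show False using y(4) by simp
  qed
  \<comment> \<open>Every nonzero functional attains the value \<open>g\<close>: for
    \<open>z r z\<close> nonzero, \<open>z (e r g)\<close> is a nonzero element of
    \<open>g R g = {0, g}\<close>.\<close>
  have dual: "\<exists>x \<in> carrier R. e \<otimes> x = x \<and> x \<otimes> g = x \<and> z \<otimes> x = g"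
    if z: "z \<in> carrier R" "g \<otimes> z = z" "z \<otimes> e = z" "z \<noteq> \<zero>" for z
  proof -
    obtain r where r: "r \<in> carrier R" "z \<otimes> r \<otimes> z \<noteq> \<zero>" using semiprime[OF z(1)] z(4) by blast
    let ?x = "e \<otimes> r \<otimes> g"
    have zx: "z \<otimes> ?x = g \<otimes> (z \<otimes> r) \<otimes> g"
    proof -
      have "z \<otimes> ?x = (z \<otimes> e) \<otimes> r \<otimes> g" using z(1) r(1) g(1) D(1) by (simp only: m_assoc m_closed)
      also have "\<dots> = (g \<otimes> z) \<otimes> r \<otimes> g" by (simp add: z)
      finally show ?thesis using z(1) r(1) g(1) by (simp only: m_assoc m_closed)
    qed
    have "g \<otimes> (z \<otimes> r) \<otimes> g \<noteq> \<zero>"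
    proof
      assume "g \<otimes> (z \<otimes> r) \<otimes> g = \<zero>"
      then have "(g \<otimes> (z \<otimes> r) \<otimes> g) \<otimes> z = \<zero>" using z by simp
      then have "(g \<otimes> z) \<otimes> r \<otimes> (g \<otimes> z) = \<zero>" using z(1) r(1) g(1) by (simp only: m_assoc m_closed)
      then show False using r z by simp
    qed
    then have "z \<otimes> ?x = g" using bin[of "z \<otimes> r"] z(1) r(1) zx by simp
    moreover have "e \<otimes> ?x = ?x"
      using r(1) g(1) D(1,3) by (simp add: m_assoc[symmetric])
    moreover have "?x \<otimes> g = ?x" using r(1) g D(1) by (simp add: m_assoc)
    moreover have "?x \<in> carrier R" using r(1) g(1) D(1) by simp
    ultimately show ?thesis by blast
  qed
  have val: "z \<otimes> x = \<zero> \<or> z \<otimes> x = g" if "z \<in> carrier R" "g \<otimes> z = z" "x \<in> carrier R" "x \<otimes> g = x" for z x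
  proof -
    have "g \<otimes> (z \<otimes> x) \<otimes> g = (g \<otimes> z) \<otimes> (x \<otimes> g)" using that(1,3) g(1) by (simp only: m_assoc m_closed)
    then show ?thesis using bin[of "z \<otimes> x"] that by simp
  qed
  obtain p where p: "p \<in> carrier R" "e \<otimes> p = p" "p \<otimes> g = p" "y1 \<otimes> p = g"
    using dual[OF yc(1) y1 y10] by blast
  have "g \<otimes> (y1 \<ominus> y2) = y1 \<ominus> y2" "(y1 \<ominus> y2) \<otimes> e = y1 \<ominus> y2"
    using yc g(1) D(1) y1 y2 by (simp_all add: minus_eq l_distr r_distr l_minus r_minus)
  then obtain q where q: "q \<in> carrier R" "e \<otimes> q = q" "q \<otimes> g = q" "(y1 \<ominus> y2) \<otimes> q = g"
    using dual[OF _ _ _ y12] yc by auto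
  have q': "y1 \<otimes> q \<ominus> y2 \<otimes> q = g" using q yc by (simp add: minus_eq l_distr l_minus)
  have ming: "\<ominus> g = g" using gg g(1) by (metis minus_equality)
  \<comment> \<open>Here \<open>y1 p = g\<close> and \<open>y1 q - y2 q = g\<close>. Either
    \<open>p\<close> or \<open>q\<close> is already a solution, or \<open>y2 p = g\<close> and
    \<open>y1 q = 0\<close>, and then \<open>p + q\<close> is one because
    \<open>g + g = 0\<close>.\<close>
  consider "y2 \<otimes> p = \<zero>" | "y1 \<otimes> q = g" | "y2 \<otimes> p = g" "y1 \<otimes> q = \<zero>"
    using val[OF yc(2) y2(1) p(1,3)] val[OF yc(1) y1(1) q(1,3)] by blast
  then have "\<exists>x \<in> carrier R. e \<otimes> x = x \<and> x \<otimes> g = x \<and> y1 \<otimes> x = g \<and> y2 \<otimes> x = \<zero>"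
  proof cases
    case 1
    then show ?thesis using p by blast
  next
    case 2
    have "y2 \<otimes> q \<noteq> g"
    proof
      assume "y2 \<otimes> q = g"
      then have "g = \<zero>" using q' 2 g(1) by (simp add: minus_eq r_neg)
      then show False using g(3) by simp
    qed
    then have "y2 \<otimes> q = \<zero>" using val[OF yc(2) y2(1) q(1,3)] by simp
    then show ?thesis using q 2 by blast
  next
    case 3
    have "y2 \<otimes> q \<noteq> \<zero>" using q' 3 g(3) by (auto simp: minus_eq)
    then have "y2 \<otimes> q = g" using val[OF yc(2) y2(1) q(1,3)] by simp
    then have "y1 \<otimes> (p \<oplus> q) = g" "y2 \<otimes> (p \<oplus> q) = \<zero>"
      using 3 p q yc gg g(1) by (simp_all add: r_distr)
    moreover have "e \<otimes> (p \<oplus> q) = p \<oplus> q" "(p \<oplus> q) \<otimes> g = p \<oplus> q" "p \<oplus> q \<in> carrier R"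
      using p q D(1) g(1) by (simp_all add: l_distr r_distr)
    ultimately show ?thesis by blast
  qed
  then show ?thesis unfolding y1_def y2_def .
qed

text \<open>The relations between \<open>e\<close> and \<open>e'\<close> make
  \<open>R (1 - e')\<close> strictly smaller than \<open>R (1 - e)\<close>, which is what the
  minimality argument needs. The cases look for a usable entry in the row of \<open>g\<close> with
  respect to \<open>e\<close>, \<open>g\<close> and the remaining idempotent
  \<open>1 - e - g\<close>.\<close>

lemma unit_pair_extend:
  assumes G: "unit_pair e u" and e1: "e \<noteq> \<one>" and nb: "\<And>g. \<not> binary_central g"
  shows "\<exists>e' u'. unit_pair e' u' \<and> e' \<otimes> e = e \<and> e \<otimes> e' = e \<and> e' \<noteq> e"
proof -
  note D = unit_pairD[OF G]
  let ?f = "\<one> \<ominus> e"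
  have fc: "?f \<in> carrier R" using D by simp
  have ef: "e \<otimes> ?f = \<zero>" "?f \<otimes> e = \<zero>"
    using D(1,3) by (simp_all add: minus_eq l_distr r_distr l_minus r_minus r_neg)
  have "?f \<otimes> ?f = ?f \<ominus> e \<otimes> ?f" using D(1) by algebra
  then have ff: "?f \<otimes> ?f = ?f" using ef fc by (simp add: minus_eq)
  have f0: "?f \<noteq> \<zero>" using e1 D(1) by simp
  obtain g where g: "primitive g" "?f \<otimes> g = g" "g \<otimes> ?f = g"
    using ex_primitive[OF fc ff f0] by blast
  note p = primitiveD(1-3)[OF g(1)]
  have o: "e \<otimes> g = \<zero>" "g \<otimes> e = \<zero>"
  proof -
    have "e \<otimes> g = (e \<otimes> ?f) \<otimes> g" using D(1) p(1) fc g(2) by (simp only: m_assoc)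
    then show "e \<otimes> g = \<zero>" using ef p by simp
    have "g \<otimes> e = g \<otimes> (?f \<otimes> e)" using D(1) p(1) fc g(3) by (simp only: m_assoc[symmetric])
    then show "g \<otimes> e = \<zero>" using ef p by simp
  qed
  have ext: ?thesis if "unit_pair (e \<oplus> k) u'" "k \<in> carrier R" "k \<otimes> e = \<zero>" "e \<otimes> k = \<zero>" "k \<noteq> \<zero>" for k u'
  proof (intro exI conjI)
    show "unit_pair (e \<oplus> k) u'" by fact
    show "(e \<oplus> k) \<otimes> e = e" "e \<otimes> (e \<oplus> k) = e"
      using that D(1,3) by (simp_all add: l_distr r_distr)
    show "e \<oplus> k \<noteq> e" using that(2,5) D(1) add.r_cancel_one[of e k] by simp
  qed
  show ?thesis
  proof (cases "\<forall>r \<in> carrier R. g \<otimes> r \<otimes> g = \<zero> \<or> g \<otimes> r \<otimes> g = g")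
    case False
    then obtain r where r: "r \<in> carrier R" "g \<otimes> r \<otimes> g \<noteq> \<zero>" "g \<otimes> r \<otimes> g \<noteq> g" by blast
    have "unit_pair (e \<oplus> g) (u \<oplus> g \<otimes> r \<otimes> g)"
      by (rule unit_pair_add_division[OF G g(1) o]) (use r p in \<open>simp_all add: m_assoc, simp_all add: m_assoc[symmetric]\<close>)
    then show ?thesis by (rule ext) (use p o in auto)
  next
    case True
    then have bin: "\<And>r. r \<in> carrier R \<Longrightarrow> g \<otimes> r \<otimes> g = \<zero> \<or> g \<otimes> r \<otimes> g = g" by blast
    let ?k = "?f \<ominus> g"
    have kc: "?k \<in> carrier R" using fc p by simp
    have k: "e \<otimes> ?k = \<zero>" "?k \<otimes> e = \<zero>" "g \<otimes> ?k = \<zero>" "?k \<otimes> g = \<zero>"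
    proof -
      have "e \<otimes> ?k = e \<otimes> ?f \<ominus> e \<otimes> g" "?k \<otimes> e = ?f \<otimes> e \<ominus> g \<otimes> e"
        "g \<otimes> ?k = g \<otimes> ?f \<ominus> g \<otimes> g" "?k \<otimes> g = ?f \<otimes> g \<ominus> g \<otimes> g"
        using D(1) p(1) fc by (simp_all only: minus_eq l_distr r_distr l_minus r_minus a_inv_closed)
      then show "e \<otimes> ?k = \<zero>" "?k \<otimes> e = \<zero>" "g \<otimes> ?k = \<zero>" "?k \<otimes> g = \<zero>"
        unfolding ef o g p using p by (simp_all add: minus_eq r_neg)
    qed
    have kk: "?k \<otimes> ?k = ?k"
    proof -
      have "?k \<otimes> ?k = ?k \<ominus> e \<otimes> ?k \<ominus> g \<otimes> ?k" using D(1) p(1) by algebra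
      then show ?thesis unfolding k using kc by (simp add: minus_eq)
    qed
    show ?thesis
    proof (cases "\<forall>r \<in> carrier R. g \<otimes> r \<otimes> ?k = \<zero>")
      case False
      then obtain r where r: "r \<in> carrier R" "g \<otimes> r \<otimes> ?k \<noteq> \<zero>" by blast
      define a where "a = g \<otimes> r \<otimes> ?k"
      have a: "a \<in> carrier R" "a \<noteq> \<zero>" using r p kc by (simp_all add: a_def)
      have ga: "g \<otimes> a = a" using r(1) p kc by (simp add: a_def m_assoc[symmetric])
      have aright: "a \<otimes> w = g \<otimes> r \<otimes> (?k \<otimes> w)" if "w \<in> carrier R" for w
        using r(1) p(1) kc that by (simp only: a_def m_assoc m_closed)
      have ak: "a \<otimes> ?k = a" "a \<otimes> g = \<zero>" "a \<otimes> e = \<zero>"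
        using aright[OF kc] aright[OF p(1)] aright[OF D(1)] r(1) p(1) unfolding k kk by (simp_all add: a_def)
      \<comment> \<open>Semiprimeness supplies the opposite matrix unit: with
        \<open>b = ?k s g\<close>, the product \<open>a b\<close> lies in \<open>g R g\<close> and
        \<open>a b a = a s a\<close> is nonzero, so \<open>a b = g\<close>.\<close>
      obtain s where s: "s \<in> carrier R" "a \<otimes> s \<otimes> a \<noteq> \<zero>" using semiprime[OF a(1)] a(2) by blast
      define b where "b = ?k \<otimes> s \<otimes> g"
      have b: "b \<in> carrier R" "b \<otimes> g = b" using s p kc by (simp_all add: b_def m_assoc)
      have bleft: "w \<otimes> b = (w \<otimes> ?k) \<otimes> (s \<otimes> g)" if "w \<in> carrier R" for w
        using s(1) p(1) kc that by (simp only: b_def m_assoc m_closed)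
      have gb: "g \<otimes> b = \<zero>" "e \<otimes> b = \<zero>"
        using bleft[OF p(1)] bleft[OF D(1)] s(1) p(1) unfolding k by simp_all
      have ab: "a \<otimes> b = g \<otimes> (a \<otimes> s) \<otimes> g"
      proof -
        have "a \<otimes> b = a \<otimes> (s \<otimes> g)" using bleft[OF a(1)] ak by simp
        also have "\<dots> = (g \<otimes> a) \<otimes> (s \<otimes> g)" unfolding ga ..
        finally show ?thesis using a(1) s(1) p(1) by (simp only: m_assoc m_closed)
      qed
      have "a \<otimes> b \<noteq> \<zero>"
      proof
        assume "a \<otimes> b = \<zero>"
        then have "(g \<otimes> (a \<otimes> s) \<otimes> g) \<otimes> a = \<zero>" using ab a(1) by simp
        then have "(g \<otimes> a) \<otimes> s \<otimes> (g \<otimes> a) = \<zero>" using a(1) s(1) p(1) by (simp only: m_assoc m_closed)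
        then show False using s(2) by (simp add: ga)
      qed
      then have abg: "a \<otimes> b = g" using bin[of "a \<otimes> s"] a(1) s(1) ab by simp
      have M: "unit_pair (e \<oplus> (g \<oplus> b \<otimes> a)) (u \<oplus> (a \<oplus> (b \<oplus> b \<otimes> a)))"
        by (rule unit_pair_add_matrix_units[OF G p(1) o a(1) b(1) abg ga b(2) ak(2) gb(1) ak(3) gb(2)])
      have ba: "e \<otimes> (b \<otimes> a) = \<zero>" "b \<otimes> a \<otimes> e = \<zero>" "g \<otimes> (b \<otimes> a) = \<zero>"
      proof -
        have "e \<otimes> (b \<otimes> a) = (e \<otimes> b) \<otimes> a" "g \<otimes> (b \<otimes> a) = (g \<otimes> b) \<otimes> a" "b \<otimes> a \<otimes> e = b \<otimes> (a \<otimes> e)"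
          using a(1) b(1) D(1) p(1) by (simp_all only: m_assoc)
        then show "e \<otimes> (b \<otimes> a) = \<zero>" "b \<otimes> a \<otimes> e = \<zero>" "g \<otimes> (b \<otimes> a) = \<zero>"
          unfolding gb ak using a(1) b(1) by simp_all
      qed
      show ?thesis
      proof (rule ext[OF M])
        show "g \<oplus> b \<otimes> a \<noteq> \<zero>"
        proof
          assume "g \<oplus> b \<otimes> a = \<zero>"
          then have "g \<otimes> (g \<oplus> b \<otimes> a) = \<zero>" using p by simp
          then show False using p a(1) b(1) ba by (simp add: r_distr)
        qed
      qed (use p a(1) b(1) D(1) o ba in \<open>simp_all add: l_distr r_distr\<close>)
    next
      case noK: True
      show ?thesis
      proof (cases "\<forall>r \<in> carrier R. g \<otimes> r \<otimes> e = \<zero>")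
        case False
        then obtain r where r: "r \<in> carrier R" "g \<otimes> r \<otimes> e \<noteq> \<zero>" by blast
        define y where "y = g \<otimes> r \<otimes> e"
        have y: "y \<in> carrier R" "y \<noteq> \<zero>" "y \<otimes> e = y" using r p D(1,3) by (simp_all add: y_def m_assoc)
        have gy: "g \<otimes> y = y" using r(1) p D(1) by (simp add: y_def m_assoc[symmetric])
        obtain x where x: "x \<in> carrier R" "e \<otimes> x = x" "x \<otimes> g = x"
          "y \<otimes> inv ((\<one> \<ominus> e) \<oplus> u) \<otimes> x = g" "y \<otimes> inv (\<one> \<ominus> u) \<otimes> x = \<zero>"
          using ex_linking_elements[OF G p bin y(1) gy y(3) y(2)] by blast
        have "unit_pair (e \<oplus> g) (u \<oplus> (x \<oplus> y))"
          by (rule unit_pair_add_linked[OF G p(1,2) o x(1-3) y(1) gy y(3) x(4,5)])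
        then show ?thesis by (rule ext) (use p o in auto)
      next
        case noE: True
        have "binary_central g"
        proof (rule binary_centralI[OF p bin])
          fix r assume r: "r \<in> carrier R"
          \<comment> \<open>Splitting \<open>1 = ?k + e + g\<close>, only the \<open>g R g\<close>
            entry of the row of \<open>g\<close> survives.\<close>
          have "g \<otimes> r = g \<otimes> r \<otimes> ?k \<oplus> (g \<otimes> r \<otimes> e \<oplus> g \<otimes> r \<otimes> g)"
            using r p(1) D(1) by (simp add: ring_simprules l_minus r_minus)
          then show "g \<otimes> r \<otimes> g = g \<otimes> r" using noK noE r p(1) by simp
        qed
        then show ?thesis using nb by blast
      qed
    qed
  qed
qed

lemma ex_unit_pair_or_binary_central:
  "(\<exists>u. u \<in> Units R \<and> \<one> \<ominus> u \<in> Units R) \<or> (\<exists>g. binary_central g)"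
proof (rule disjCI)
  assume "\<nexists>g. binary_central g"
  then have nb: "\<And>g. \<not> binary_central g" by blast
  let ?I = "\<lambda>e. (\<lambda>r. r \<otimes> (\<one> \<ominus> e)) ` carrier R"
  define S where "S = {?I e | e. \<exists>u. unit_pair e u}"
  \<comment> \<open>The zero corner starts the family: both test elements are
    \<open>1\<close>.\<close>
  have "unit_pair \<zero> \<zero>" by (simp add: unit_pair_def minus_eq)
  then have "S \<noteq> {}" unfolding S_def by blast
  moreover have "left_ideal R I" if "I \<in> S" for I
    using that left_ideal_principal unit_pairD(1) unfolding S_def by auto
  ultimately have "\<exists>L \<in> S. \<forall>I \<in> S. I \<subseteq> L \<longrightarrow> I = L" by (rule minimal_left_ideal_in)
  then obtain L where "L \<in> S" and Lmin: "\<forall>I \<in> S. I \<subseteq> L \<longrightarrow> I = L" by blast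
  from this(1) obtain e u where L: "L = ?I e" and G: "unit_pair e u" unfolding S_def by blast
  have min: "?I e' = ?I e" if "unit_pair e' u'" "?I e' \<subseteq> ?I e" for e' u'
  proof -
    have "?I e' \<in> S" using that(1) unfolding S_def by blast
    then show ?thesis using Lmin that(2) unfolding L by simp
  qed
  note D = unit_pairD[OF G]
  have "e = \<one>"
  proof (rule ccontr)
    assume "e \<noteq> \<one>"
    from unit_pair_extend[OF G this nb] obtain e' u' where E: "unit_pair e' u'" "e' \<otimes> e = e" "e \<otimes> e' = e" "e' \<noteq> e"
      by blast
    note D' = unit_pairD[OF E(1)]
    have sub: "\<one> \<ominus> e' = (\<one> \<ominus> e') \<otimes> (\<one> \<ominus> e)"
    proof -
      have "(\<one> \<ominus> e') \<otimes> (\<one> \<ominus> e) = \<one> \<ominus> e' \<ominus> (e \<ominus> e' \<otimes> e)" using D(1) D'(1) by (simp add: ring_simprules l_minus r_minus)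
      then show ?thesis using E(2) D(1) D'(1) by (simp add: minus_eq r_neg)
    qed
    have "?I e' \<subseteq> ?I e"
    proof (clarify)
      fix r assume r: "r \<in> carrier R"
      have "r \<otimes> (\<one> \<ominus> e') = (r \<otimes> (\<one> \<ominus> e')) \<otimes> (\<one> \<ominus> e)"
        using r D(1) D'(1) sub by (simp add: m_assoc)
      then show "r \<otimes> (\<one> \<ominus> e') \<in> ?I e" by (rule image_eqI) (use r D'(1) in simp)
    qed
    then have "?I e' = ?I e" by (rule min[OF E(1)])
    moreover have "\<one> \<ominus> e \<in> ?I e" using D(1) by (intro image_eqI[of _ _ \<one>]) auto
    ultimately obtain r where r: "r \<in> carrier R" "\<one> \<ominus> e = r \<otimes> (\<one> \<ominus> e')" by blast
    \<comment> \<open>Equality of the left ideals puts \<open>1 - e\<close> in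
      \<open>R (1 - e')\<close>. Hence \<open>(1 - e) e' = 0\<close>, so
      \<open>e' = e e' = e\<close>.\<close>
    have "e' \<ominus> e \<otimes> e' = (\<one> \<ominus> e) \<otimes> e'" using D(1) D'(1) by (simp add: ring_simprules l_minus r_minus)
    also have "\<dots> = r \<otimes> (e' \<ominus> e' \<otimes> e')" unfolding r(2) using r(1) D'(1) by (simp add: ring_simprules l_minus r_minus)
    also have "\<dots> = \<zero>" using r(1) D'(1,3) by (simp add: minus_eq r_neg)
    finally have "e' = e" using E(3) D(1) D'(1) by simp
    then show False using E(4) by simp
  qed
  then have "u \<in> Units R" using D(2,6) by (simp add: minus_eq r_neg)
  then show "\<exists>u. u \<in> Units R \<and> \<one> \<ominus> u \<in> Units R" using D(7) by blast
qed

subsection \<open>Isomorphism types\<close>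

lemma binary_central_has_summand:
  assumes "binary_central g"
  shows "has_summand R (residue_ring 2)"
proof -
  from assms have g: "g \<in> carrier R" "g \<otimes> g = g" "g \<noteq> \<zero>"
    and comm: "\<And>r. r \<in> carrier R \<Longrightarrow> r \<otimes> g = g \<otimes> r"
    and bin: "\<And>r. r \<in> carrier R \<Longrightarrow> g \<otimes> r = \<zero> \<or> g \<otimes> r = g"
    by (auto simp: binary_central_def)
  \<comment> \<open>The complementary factor is \<open>(1 - g) R\<close>, described as the
    annihilator of \<open>g\<close>; its identity is \<open>1 - g\<close>, and it is the zero ring
    when \<open>g = 1\<close>.\<close>
  define S :: "'a ring" where
    "S = \<lparr>carrier = {x \<in> carrier R. g \<otimes> x = \<zero>}, monoid.mult = (\<otimes>), one = \<one> \<ominus> g,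
      ring.zero = \<zero>, ring.add = (\<oplus>)\<rparr>"
  have S: "carrier S = {x \<in> carrier R. g \<otimes> x = \<zero>}" "\<And>x y. x \<otimes>\<^bsub>S\<^esub> y = x \<otimes> y"
    "\<And>x y. x \<oplus>\<^bsub>S\<^esub> y = x \<oplus> y" "\<one>\<^bsub>S\<^esub> = \<one> \<ominus> g" "\<zero>\<^bsub>S\<^esub> = \<zero>"
    by (simp_all add: S_def)
  have gg: "g \<oplus> g = \<zero>"
  proof -
    have "g \<otimes> (\<one> \<oplus> \<one>) = g \<oplus> g" using g by (simp add: r_distr)
    then have "g \<oplus> g = \<zero> \<or> g \<oplus> g = g" using bin[of "\<one> \<oplus> \<one>"] by simp
    then show ?thesis using g(1,3) add.r_cancel_one[of g g] by auto
  qed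
  have gswap: "g \<otimes> (x \<otimes> y) = x \<otimes> (g \<otimes> y)" if "x \<in> carrier R" "y \<in> carrier R" for x y
    using that g(1) comm[OF that(1)] by (simp flip: m_assoc)
  have "ring S"
  proof (rule ringI)
    show "abelian_group S"
    proof (rule abelian_groupI)
      fix x assume "x \<in> carrier S"
      then show "\<exists>y\<in>carrier S. y \<oplus>\<^bsub>S\<^esub> x = \<zero>\<^bsub>S\<^esub>"
        unfolding S using g by (intro bexI[of _ "\<ominus> x"]) (auto simp: r_minus l_neg)
    qed (use g in \<open>auto simp: S r_distr a_ac\<close>)
    show "monoid S"
    proof (rule monoidI)
      show "\<one>\<^bsub>S\<^esub> \<in> carrier S" using g by (simp add: S minus_eq r_distr r_minus r_neg)
      fix x assume "x \<in> carrier S"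
      then have x: "x \<in> carrier R" "g \<otimes> x = \<zero>" "x \<otimes> g = \<zero>" using comm[of x] by (simp_all add: S)
      then show "\<one>\<^bsub>S\<^esub> \<otimes>\<^bsub>S\<^esub> x = x" "x \<otimes>\<^bsub>S\<^esub> \<one>\<^bsub>S\<^esub> = x"
        using g by (simp_all add: S minus_eq l_distr r_distr l_minus r_minus)
    qed (auto simp: S gswap m_assoc)
  qed (auto simp: S l_distr r_distr)
  let ?p = "\<lambda>x. x \<ominus> g \<otimes> x"
  \<comment> \<open>The Peirce decomposition \<open>x = g x + (x - g x)\<close>: the first
    coordinate records whether \<open>g x\<close> is \<open>0\<close> or \<open>g\<close>, the
    second is the projection to \<open>S\<close>.\<close>
  let ?h = "\<lambda>x. (if g \<otimes> x = \<zero> then 0 else 1 :: int, ?p x)"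
  let ?Z = "residue_ring 2"
  have D: "carrier (RDirProd ?Z S) = {0..1} \<times> carrier S"
    "\<And>p q. p \<otimes>\<^bsub>RDirProd ?Z S\<^esub> q = ((fst p * fst q) mod 2, snd p \<otimes> snd q)"
    "\<And>p q. p \<oplus>\<^bsub>RDirProd ?Z S\<^esub> q = ((fst p + fst q) mod 2, snd p \<oplus> snd q)"
    "\<one>\<^bsub>RDirProd ?Z S\<^esub> = (1, \<one> \<ominus> g)"
    by (auto simp: RDirProd_def DirProd_def monoid.defs residue_ring_def S split: prod.splits)
  have gp: "g \<otimes> ?p x = \<zero>" if "x \<in> carrier R" for x
    using that g by (simp add: minus_eq r_distr r_minus r_neg flip: m_assoc)
  have "?h \<in> ring_iso R (RDirProd ?Z S)"
  proof (rule ring_iso_memI)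
    show "?h x \<in> carrier (RDirProd ?Z S)" if "x \<in> carrier R" for x
      using that gp g by (simp add: D S)
    show "?h (x \<otimes> y) = ?h x \<otimes>\<^bsub>RDirProd ?Z S\<^esub> ?h y" if xy: "x \<in> carrier R" "y \<in> carrier R" for x y
    proof -
      have "?p x \<otimes> ?p y = x \<otimes> y \<ominus> x \<otimes> (g \<otimes> y) \<ominus> (g \<otimes> (x \<otimes> y) \<ominus> g \<otimes> (x \<otimes> (g \<otimes> y)))"
        using xy g(1) by (simp add: minus_eq l_distr r_distr l_minus r_minus minus_add m_assoc a_ac)
      also have "x \<otimes> (g \<otimes> y) = g \<otimes> (x \<otimes> y)" using gswap xy by simp
      also have "g \<otimes> (g \<otimes> (x \<otimes> y)) = g \<otimes> (x \<otimes> y)" using xy g by (simp flip: m_assoc)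
      finally have "?p x \<otimes> ?p y = ?p (x \<otimes> y)"
        using xy g(1) by (simp add: minus_eq r_neg)
      moreover have "g \<otimes> (x \<otimes> y) = (g \<otimes> x) \<otimes> (g \<otimes> y)"
        using xy g comm[OF xy(1)] by (metis m_assoc m_closed)
      then have "g \<otimes> (x \<otimes> y) = \<zero> \<longleftrightarrow> g \<otimes> x = \<zero> \<or> g \<otimes> y = \<zero>"
        using bin[OF xy(1)] bin[OF xy(2)] g by auto
      ultimately show ?thesis by (simp add: D)
    qed
    show "?h (x \<oplus> y) = ?h x \<oplus>\<^bsub>RDirProd ?Z S\<^esub> ?h y" if xy: "x \<in> carrier R" "y \<in> carrier R" for x y
    proof -
      have "?p x \<oplus> ?p y = ?p (x \<oplus> y)"
        using xy g(1) by (simp add: minus_eq r_distr minus_add a_ac)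
      moreover have "g \<otimes> (x \<oplus> y) = \<zero> \<longleftrightarrow> (g \<otimes> x = \<zero> \<longleftrightarrow> g \<otimes> y = \<zero>)"
        using bin[OF xy(1)] bin[OF xy(2)] g gg xy by (auto simp: r_distr)
      ultimately show ?thesis by (simp add: D)
    qed
    show "?h \<one> = \<one>\<^bsub>RDirProd ?Z S\<^esub>" using g by (simp add: D)
    show "bij_betw ?h (carrier R) (carrier (RDirProd ?Z S))"
    proof (rule bij_betw_imageI)
      show "inj_on ?h (carrier R)"
      proof (rule inj_onI)
        fix x y assume xy: "x \<in> carrier R" "y \<in> carrier R" and eq: "?h x = ?h y"
        have "g \<otimes> x = g \<otimes> y"
          using eq bin[OF xy(1)] bin[OF xy(2)] by (auto split: if_splits)
        moreover have "?p x = ?p y" using eq by simp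
        ultimately have "?p x \<oplus> g \<otimes> x = ?p y \<oplus> g \<otimes> y" by simp
        then show "x = y" using xy g(1) by (simp add: minus_eq a_assoc l_neg)
      qed
      show "?h ` carrier R = carrier (RDirProd ?Z S)"
      proof
        show "?h ` carrier R \<subseteq> carrier (RDirProd ?Z S)" using gp g by (auto simp: D S)
        show "carrier (RDirProd ?Z S) \<subseteq> ?h ` carrier R"
        proof
          fix p assume "p \<in> carrier (RDirProd ?Z S)"
          then obtain i s where p: "p = (i, s)" "i = 0 \<or> i = 1" "s \<in> carrier R" "g \<otimes> s = \<zero>"
            unfolding D S by force
          let ?x = "if i = 0 then s else s \<oplus> g"
          have "?h ?x = p"
            using p g by (auto simp: r_distr minus_eq a_assoc r_neg)
          moreover have "?x \<in> carrier R" using p g by simp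
          ultimately show "p \<in> ?h ` carrier R" by (rule image_eqI[OF sym])
        qed
      qed
    qed
  qed
  then have "R \<simeq> RDirProd ?Z S" unfolding is_ring_iso_def by blast
  then show ?thesis unfolding has_summand_def using \<open>ring S\<close> by blast
qed

section \<open>The case where \<open>2\<close> is a unit\<close>

lemma one_plus_idempotent_Units:
  assumes two: "\<one> \<oplus> \<one> \<in> Units R" and e: "e \<in> carrier R" "e \<otimes> e = e"
  shows "\<one> \<oplus> e \<in> Units R"
proof (rule Units_if_right_regular)
  fix r assume r: "r \<in> carrier R" and z: "r \<otimes> (\<one> \<oplus> e) = \<zero>"
  \<comment> \<open>Because \<open>e\<close> is idempotent, \<open>(1 + e) e = 2 e\<close>. So
    \<open>r e\<close> is killed by the unit \<open>2\<close>, and \<open>r (1 + e) = 0\<close>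
    reduces to \<open>r = 0\<close>.\<close>
  have "r \<otimes> e \<otimes> (\<one> \<oplus> \<one>) = r \<otimes> (e \<oplus> e \<otimes> e)" using r e by (simp add: r_distr m_assoc)
  also have "\<dots> = r \<otimes> (\<one> \<oplus> e) \<otimes> e" using r e(1) by (simp add: r_distr l_distr m_assoc)
  finally have "r \<otimes> e \<otimes> (\<one> \<oplus> \<one>) = \<zero>" using z e by simp
  then have "r \<otimes> e = \<zero>" using Units_cancel[OF two] r e by simp
  then show "r = \<zero>" using z r e by (simp add: r_distr)
qed (use e in simp)

lemma iso_residue_ring_3:
  assumes nz: "\<one> \<noteq> \<zero>" and two: "\<one> \<oplus> \<one> \<in> Units R" and bip: "bipartite (unit_graph R)"
  shows "R \<simeq> residue_ring 3"
proof -
  have idem: "e = \<zero> \<or> e = \<one>" if e: "e \<in> carrier R" "e \<otimes> e = e" for e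
  proof (rule ccontr)
    assume ne: "\<not> (e = \<zero> \<or> e = \<one>)"
    let ?f = "\<one> \<ominus> e"
    have f: "?f \<in> carrier R" "?f \<otimes> ?f = ?f" "e \<otimes> ?f = \<zero>"
      using e by (simp_all add: minus_eq l_distr r_distr l_minus r_minus r_neg)
    have "e \<noteq> ?f" using f(3) e ne by auto
    moreover have "\<one> \<noteq> ?f"
    proof
      assume "\<one> = ?f"
      then have "e \<otimes> \<one> = \<zero>" using f(3) by simp
      then show False using e ne by simp
    qed
    moreover have "e \<oplus> \<one> \<in> Units R" "\<one> \<oplus> ?f \<in> Units R"
      using one_plus_idempotent_Units[OF two] e f a_comm[OF e(1)] by simp_all
    moreover have "e \<oplus> ?f = \<one>" using e a_lcomm[of e \<one> "\<ominus> e"] by (simp add: minus_eq r_neg)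
    ultimately show False
      using not_bipartite_triangle[of e \<one> ?f] bip ne e f by simp
  qed
  obtain g where g: "primitive g" using ex_primitive[of \<one>] nz by auto
  \<comment> \<open>The only nonzero idempotent is \<open>1\<close>, so \<open>R\<close> itself is a
    minimal left ideal and nonzero elements have left inverses.\<close>
  have "g = \<one>" using primitiveD[OF g] idem by blast
  then have inv: "\<exists>s \<in> carrier R. s \<otimes> x = \<one>" if "x \<in> carrier R" "x \<noteq> \<zero>" for x
    using primitiveD(4)[OF g, of x] that by simp
  have units: "x \<in> Units R" if x: "x \<in> carrier R" "x \<noteq> \<zero>" for x
  proof (rule Units_if_right_regular[OF x(1)])
    fix r assume r: "r \<in> carrier R" and z: "r \<otimes> x = \<zero>"
    show "r = \<zero>"
    proof (rule ccontr)
      assume "r \<noteq> \<zero>"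
      then obtain s where s: "s \<in> carrier R" "s \<otimes> r = \<one>" using inv r by blast
      have "x = s \<otimes> (r \<otimes> x)" using s r x by (simp flip: m_assoc)
      then show False using z s x by simp
    qed
  qed
  have all: "x = \<zero> \<or> x = \<one> \<or> x = \<ominus> \<one>" if x: "x \<in> carrier R" for x
  proof (rule ccontr)
    assume n: "\<not> ?thesis"
    have "\<one> \<oplus> x \<noteq> \<zero>"
    proof
      assume "\<one> \<oplus> x = \<zero>"
      then have "x \<oplus> \<one> = \<zero>" using x a_comm by simp
      then have "x = \<ominus> \<one>" using x minus_equality[of x \<one>] by simp
      then show False using n by simp
    qed
    then have "\<one> \<oplus> x \<in> Units R" using units x by simp
    then show False
      using not_bipartite_triangle[of \<zero> \<one> x] bip n nz x units[OF x] by auto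
  qed
  have two0: "\<one> \<oplus> \<one> \<noteq> \<zero>" using zero_neq_Units[OF nz two] by simp
  have "\<one> \<oplus> \<one> \<noteq> \<one>" using nz add.r_cancel_one[of \<one> \<one>] by simp
  \<comment> \<open>The element \<open>2\<close> is nonzero as a unit and differs from
    \<open>1\<close>, so of the three possible elements it must be \<open>-1\<close>; this fixes the
    addition table.\<close>
  then have oo: "\<one> \<oplus> \<one> = \<ominus> \<one>" using all[of "\<one> \<oplus> \<one>"] two0 by simp
  have mm: "\<ominus> \<one> \<oplus> \<ominus> \<one> = \<one>"
  proof -
    have "\<ominus> \<one> \<oplus> \<ominus> \<one> = \<ominus> (\<one> \<oplus> \<one>)" by (simp add: minus_add)
    then show ?thesis by (simp add: oo)
  qed
  have m1: "\<ominus> \<one> \<noteq> \<one>" "\<ominus> \<one> \<noteq> \<zero>"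
    using two0 \<open>\<one> \<oplus> \<one> \<noteq> \<one>\<close> unfolding oo by auto
  let ?h = "\<lambda>x. if x = \<zero> then 0 else if x = \<one> then 1 else 2 :: int"
  let ?Z = "residue_ring 3"
  have Z: "carrier ?Z = {0, 1, 2}" "\<And>a b. a \<otimes>\<^bsub>?Z\<^esub> b = (a * b) mod 3"
    "\<And>a b. a \<oplus>\<^bsub>?Z\<^esub> b = (a + b) mod 3" "\<one>\<^bsub>?Z\<^esub> = 1"
    by (auto simp: residue_ring_def)
  have carr: "carrier R = {\<zero>, \<one>, \<ominus> \<one>}" using all by auto
  have "?h \<in> ring_iso R ?Z"
  proof (rule ring_iso_memI)
    show "?h x \<in> carrier ?Z" if "x \<in> carrier R" for x by (simp add: Z)
    show "?h (x \<otimes> y) = ?h x \<otimes>\<^bsub>?Z\<^esub> ?h y" if "x \<in> carrier R" "y \<in> carrier R" for x y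
      using all[OF that(1)] all[OF that(2)] nz m1 unfolding Z
      by (elim disjE) (simp_all add: l_minus)
    show "?h (x \<oplus> y) = ?h x \<oplus>\<^bsub>?Z\<^esub> ?h y" if "x \<in> carrier R" "y \<in> carrier R" for x y
      using all[OF that(1)] all[OF that(2)] nz m1 unfolding Z
      by (elim disjE) (simp_all add: oo mm l_neg r_neg)
    show "?h \<one> = \<one>\<^bsub>?Z\<^esub>" using nz by (simp add: Z)
    show "bij_betw ?h (carrier R) (carrier ?Z)"
      using nz m1 unfolding bij_betw_def carr Z by auto
  qed
  then show ?thesis unfolding is_ring_iso_def by blast
qed

lemma bipartite_imp_iso_or_summand:
  assumes nz: "\<one> \<noteq> \<zero>" and bip: "bipartite (unit_graph R)"
  shows "R \<simeq> residue_ring 3 \<or> has_summand R (residue_ring 2)"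
proof (cases "\<one> \<oplus> \<one> \<in> Units R")
  case True
  then show ?thesis using iso_residue_ring_3 nz bip by simp
next
  case False
  have "\<exists>g. binary_central g"
  proof (rule ccontr)
    assume "\<nexists>g. binary_central g"
    then obtain u where u: "u \<in> Units R" "\<one> \<ominus> u \<in> Units R"
      using ex_unit_pair_or_binary_central by blast
    have uc: "u \<in> carrier R" using u(1) by (rule Units_closed)
    have s: "u \<oplus> (\<one> \<ominus> u) = \<one>" using uc a_lcomm[of u \<one> "\<ominus> u"] by (simp add: minus_eq r_neg)
    have "u \<noteq> \<one> \<ominus> u"
    proof
      \<comment> \<open>The three vertices of the triangle \<open>0\<close>, \<open>u\<close>,
        \<open>1 - u\<close> must be distinct; \<open>u = 1 - u\<close> would make the double of
        \<open>u\<close> equal to the unit \<open>1\<close>.\<close>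
      assume "u = \<one> \<ominus> u"
      then have "u \<oplus> u = \<one>" using s by simp
      then show False using double_not_Units[OF False uc] by simp
    qed
    then show False
      using not_bipartite_triangle[of \<zero> u "\<one> \<ominus> u"] zero_neq_Units[OF nz] u uc s bip by simp
  qed
  then show ?thesis using binary_central_has_summand by blast
qed

end

section \<open>Colourings from the two algebraic conditions\<close>

lemma (in ring) bipartite_if_iso_residue_ring_3:
  assumes "R \<simeq> residue_ring 3"
  shows "bipartite (unit_graph R)"
proof -
  obtain h where h: "h \<in> ring_iso R (residue_ring 3)"
    using assms unfolding is_ring_iso_def by blast
  have hom: "h x \<in> {0..2}" "h (x \<oplus> y) = (h x + h y) mod 3" "h (x \<otimes> y) = (h x * h y) mod 3" "h \<one> = 1"
    if "x \<in> carrier R" "y \<in> carrier R" for x y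
    using ring_iso_memE[OF h] that by (simp_all add: residue_ring_def)
  have inj: "inj_on h (carrier R)"
    using ring_iso_memE(5)[OF h] by (simp add: bij_betw_def)
  show ?thesis
  \<comment> \<open>Colour zero against nonzero: the two nonzero residues \<open>1\<close> and
    \<open>2\<close> sum to \<open>0\<close>, so they are not adjacent.\<close>
  proof (rule bipartite_unit_graphI[OF ring_axioms, of "\<lambda>x. h x = 0"])
    fix a b assume ab: "a \<in> carrier R" "b \<in> carrier R" "a \<noteq> b" "a \<oplus> b \<in> Units R"
    have ne: "h a \<noteq> h b" using inj ab(1-3) by (auto dest: inj_onD)
    have c: "inv (a \<oplus> b) \<in> carrier R" "a \<oplus> b \<in> carrier R" using ab by auto
    have "(h (a \<oplus> b) * h (inv (a \<oplus> b))) mod 3 = 1"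
      using hom(3,4)[OF c(2,1)] ab(4) by simp
    then have "h (a \<oplus> b) \<noteq> 0" by auto
    then have "(h a + h b) mod 3 \<noteq> 0" using hom(2)[OF ab(1,2)] by simp
    moreover have "h a = 0 \<or> h a = 1 \<or> h a = 2" "h b = 0 \<or> h b = 1 \<or> h b = 2"
      using hom(1)[OF ab(1,1)] hom(1)[OF ab(2,2)] by auto
    ultimately show "(h a = 0) \<noteq> (h b = 0)" using ne by auto
  qed
qed

text \<open>The projection to \<open>\<int>\<^sub>2\<close> sends units to \<open>1\<close>, so
  adjacent vertices have different images, and the projection itself is a colouring.\<close>

lemma (in ring) bipartite_if_has_summand:
  assumes "has_summand R (residue_ring 2)"
  shows "bipartite (unit_graph R)"
proof -
  obtain S :: "'a ring" and h where h: "h \<in> ring_iso R (RDirProd (residue_ring 2) S)"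
    using assms unfolding has_summand_def is_ring_iso_def by blast
  define k where "k = fst \<circ> h"
  have hom: "k x \<in> {0..1}" "k (x \<oplus> y) = (k x + k y) mod 2" "k (x \<otimes> y) = (k x * k y) mod 2" "k \<one> = 1"
    if "x \<in> carrier R" "y \<in> carrier R" for x y
    using ring_iso_memE(1-4)[OF h] that
    by (simp_all add: k_def RDirProd_def DirProd_def monoid.defs residue_ring_def mem_Times_iff
        split: prod.splits)
  show ?thesis
  proof (rule bipartite_unit_graphI[OF ring_axioms, of "\<lambda>x. k x = 0"])
    fix a b assume ab: "a \<in> carrier R" "b \<in> carrier R" "a \<noteq> b" "a \<oplus> b \<in> Units R"
    have c: "inv (a \<oplus> b) \<in> carrier R" "a \<oplus> b \<in> carrier R" using ab by auto
    have "(k (a \<oplus> b) * k (inv (a \<oplus> b))) mod 2 = 1"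
      using hom(3,4)[OF c(2,1)] ab(4) by simp
    then have "k (a \<oplus> b) \<noteq> 0" by auto
    then have "(k a + k b) mod 2 \<noteq> 0" using hom(2)[OF ab(1,2)] by simp
    moreover have "k a = 0 \<or> k a = 1" "k b = 0 \<or> k b = 1"
      using hom(1)[OF ab(1,1)] hom(1)[OF ab(2,2)] by auto
    ultimately show "(k a = 0) \<noteq> (k b = 0)" by auto
  qed
qed

theorem theorem3p2:
  fixes R :: "('a, 'b) ring_scheme" (structure)
  assumes "ring R" and "\<one> \<noteq> \<zero>"
  shows
    "(jacobson_radical R \<noteq> {\<zero>} \<and> \<one> \<oplus> \<one> \<in> Units R \<longrightarrow> \<not> bipartite (unit_graph R)) \<and>
     (\<one> \<oplus> \<one> \<notin> Units R \<longrightarrow>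
        (bipartite (unit_graph R) \<longleftrightarrow> bipartite (unit_graph (R Quot jacobson_radical R)))) \<and>
     (semisimple_ring R \<and> left_artinian R \<longrightarrow>
        (bipartite (unit_graph R) \<longleftrightarrow>
           R \<simeq> residue_ring 3 \<or> has_summand R (residue_ring 2)))"
proof (intro conjI impI)
  interpret ring R by fact
  show "\<not> bipartite (unit_graph R)" if "jacobson_radical R \<noteq> {\<zero>} \<and> \<one> \<oplus> \<one> \<in> Units R"
    using not_bipartite_if_two_unit_jacobson[OF assms(2)] that by blast
  show "bipartite (unit_graph R) \<longleftrightarrow> bipartite (unit_graph (R Quot jacobson_radical R))"
    if "\<one> \<oplus> \<one> \<notin> Units R"
    using bipartite_quotient_jacobson_iff[OF that] .
  show "bipartite (unit_graph R) \<longleftrightarrow> R \<simeq> residue_ring 3 \<or> has_summand R (residue_ring 2)"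
    if "semisimple_ring R \<and> left_artinian R"
  proof -
    interpret semisimple_artinian_ring R
      by unfold_locales (use that in \<open>auto simp: semisimple_ring_def\<close>)
    show ?thesis
      using bipartite_imp_iso_or_summand[OF assms(2)] bipartite_if_iso_residue_ring_3
        bipartite_if_has_summand by blast
  qed
qed

end
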